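(* Let $\mathcal{C}$ be a Krull-Schmidt, triangulated category. Suppose $((\mathcal{S},\mathcal{T}),(\mathcal{U},\mathcal{V}))$ is a twin cotorsion pair on $\mathcal{C}$ that satisfies $\mathcal{T}=\mathcal{U}$. Let $\mathcal{R}$ denote the class of regular morphisms in the heart $\overline{\mathcal{H}}$ of $((\mathcal{S},\mathcal{T}),(\mathcal{U},\mathcal{V}))$. Then the Gabriel-Zisman localisation $\overline{\mathcal{H}}_{\mathcal{R}}$ of $\overline{\mathcal{H}}$ at $\mathcal{R}$ is equivalent to the heart $\overline{\mathscr{H}}_{(\mathcal{S},\mathcal{T})}$ of the cotorsion pair $(\mathcal{S},\mathcal{T})$.
   Context: $\Sigma$ denotes the suspension functor of $\mathcal{C}$, "triangle" means distinguished triangle, and $\operatorname{Ext}^{1}_{\mathcal{C}}(X,Y)=\operatorname{Hom}_{\mathcal{C}}(X,\Sigma Y)$. For full subcategories $\mathcal{X},\mathcal{Y}$ of $\mathcal{C}$, $\mathcal{X}*\mathcal{Y}$ is the full subcategory of objects $C$ for which there is a triangle $X\to C\to Y\to\Sigma X$ with $X\in\mathcal{X}$, $Y\in\mathcal{Y}$. For a subcategory $\mathcal{A}$ closed under finite direct sums, $[\mathcal{A}]$ is the ideal of morphisms factoring through an object of $\mathcal{A}$. A cotorsion pair on $\mathcal{C}$ is a pair $(\mathcal{U},\mathcal{V})$ of full, additive subcategories closed under isomorphisms and direct summands such that $\operatorname{Ext}^{1}_{\mathcal{C}}(U,V)=0$ for all $U\in\mathcal{U}$, $V\in\mathcal{V}$,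 and $\mathcal{C}=\mathcal{U}*\Sigma\mathcal{V}$. A twin cotorsion pair $((\mathcal{S},\mathcal{T}),(\mathcal{U},\mathcal{V}))$ is a pair of cotorsion pairs on $\mathcal{C}$ with $\operatorname{Ext}^{1}_{\mathcal{C}}(\mathcal{S},\mathcal{V})=0$ (equivalently $\mathcal{S}\subseteq\mathcal{U}$). Heart of a twin cotorsion pair: with $\mathcal{W}=\mathcal{T}\cap\mathcal{U}$, $\mathcal{C}^{-}=\Sigma^{-1}\mathcal{S}*\mathcal{W}$, $\mathcal{C}^{+}=\mathcal{W}*\Sigma\mathcal{V}$ and $\mathcal{H}=\mathcal{C}^{-}\cap\mathcal{C}^{+}$, the heart is $\overline{\mathcal{H}}=\mathcal{H}/[\mathcal{W}]$. When $\mathcal{T}=\mathcal{U}$ one has $\mathcal{W}=\mathcal{T}=\mathcal{U}$, $\mathcal{H}=\mathcal{C}$ and $\overline{\mathcal{H}}=\mathcal{C}/[\mathcal{W}]$. Heart of a single cotorsion pair $(\mathcal{S},\mathcal{T})$: with $\mathscr{W}=\mathcal{S}\cap\mathcal{T}$, $\mathscr{C}^{-}=\Sigma^{-1}\mathcal{S}*\mathscr{W}$, $\mathscr{C}^{+}=\mathscr{W}*\Sigma\mathcal{T}$, it is $\overline{\mathscr{H}}_{(\mathcal{S},\mathcal{T})}=(\mathscr{C}^{-}\cap\mathscr{C}^{+})/[\mathscr{W}]$. When $\mathcal{T}=\mathcal{U}$ (so $\mathcal{S}\subseteq\mathcal{T}$), this equals $(\Sigma^{-1}\mathcal{S}*\mathcal{S})/[\mathcal{S}]$.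 A morphism is regular if it is both a monomorphism and an epimorphism. The localisation $\overline{\mathcal{H}}_{\mathcal{R}}$ is obtained by formally inverting the morphisms in $\mathcal{R}$ (a priori possibly requiring passage to a higher universe). *)

theory Defs
  imports "HOL-Algebra.Ring"
begin

text \<open>Categories are given by carrier sets of objects and arrows; composition is in
  applicative order, and its value on non-composable pairs is irrelevant.\<close>

record ('o, 'm) cat =
  Obj :: "'o set"
  Arr :: "'m set"
  Dom :: "'m \<Rightarrow> 'o"
  Cod :: "'m \<Rightarrow> 'o"
  Ide :: "'o \<Rightarrow> 'm"
  Cmp :: "'m \<Rightarrow> 'm \<Rightarrow> 'm"  (infixr "\<cdot>\<index>" 75)

record ('o, 'm) precat = "('o, 'm) cat" +
  Plus :: "'m \<Rightarrow> 'm \<Rightarrow> 'm"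
  Null :: "'o \<Rightarrow> 'o \<Rightarrow> 'm"

text \<open>\<open>(u, v, w) \<in> Tri C\<close> stands for the distinguished triangle
  with consecutive morphisms \<open>u\<close>, \<open>v\<close>, \<open>w\<close>.\<close>

record ('o, 'm) tricat = "('o, 'm) precat" +
  SuspO :: "'o \<Rightarrow> 'o"
  SuspA :: "'m \<Rightarrow> 'm"
  Tri :: "('m \<times> 'm \<times> 'm) set"

definition Hom :: "('o, 'm, 'z) cat_scheme \<Rightarrow> 'o \<Rightarrow> 'o \<Rightarrow> 'm set" where
  "Hom C A B = {f \<in> Arr C. Dom C f = A \<and> Cod C f = B}"

locale category =
  fixes C :: "('o, 'm, 'z) cat_scheme" (structure)
  assumes Dom_closed: "f \<in> Arr C \<Longrightarrow> Dom C f \<in> Obj C"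
    and Cod_closed: "f \<in> Arr C \<Longrightarrow> Cod C f \<in> Obj C"
    and Ide_Hom: "A \<in> Obj C \<Longrightarrow> Ide C A \<in> Hom C A A"
    and Cmp_Hom: "\<lbrakk>f \<in> Hom C A B; g \<in> Hom C B D\<rbrakk> \<Longrightarrow> g \<cdot> f \<in> Hom C A D"
    and Cmp_Ide: "f \<in> Hom C A B \<Longrightarrow> f \<cdot> Ide C A = f"
    and Ide_Cmp: "f \<in> Hom C A B \<Longrightarrow> Ide C B \<cdot> f = f"
    and Cmp_assoc: "\<lbrakk>f \<in> Hom C A B; g \<in> Hom C B D; h \<in> Hom C D E\<rbrakk>
      \<Longrightarrow> (h \<cdot> g) \<cdot> f = h \<cdot> (g \<cdot> f)"

definition is_iso :: "('o, 'm, 'z) cat_scheme \<Rightarrow> 'm \<Rightarrow> bool" where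
  "is_iso C f \<longleftrightarrow> f \<in> Arr C \<and>
    (\<exists>g \<in> Hom C (Cod C f) (Dom C f).
       g \<cdot>\<^bsub>C\<^esub> f = Ide C (Dom C f) \<and> f \<cdot>\<^bsub>C\<^esub> g = Ide C (Cod C f))"

definition monic :: "('o, 'm, 'z) cat_scheme \<Rightarrow> 'm \<Rightarrow> bool" where
  "monic C f \<longleftrightarrow> f \<in> Arr C \<and>
    (\<forall>A \<in> Obj C. \<forall>g \<in> Hom C A (Dom C f). \<forall>h \<in> Hom C A (Dom C f).
       f \<cdot>\<^bsub>C\<^esub> g = f \<cdot>\<^bsub>C\<^esub> h \<longrightarrow> g = h)"

definition epic :: "('o, 'm, 'z) cat_scheme \<Rightarrow> 'm \<Rightarrow> bool" where
  "epic C f \<longleftrightarrow> f \<in> Arr C \<and>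
    (\<forall>B \<in> Obj C. \<forall>g \<in> Hom C (Cod C f) B. \<forall>h \<in> Hom C (Cod C f) B.
       g \<cdot>\<^bsub>C\<^esub> f = h \<cdot>\<^bsub>C\<^esub> f \<longrightarrow> g = h)"

definition regular_arrows :: "('o, 'm, 'z) cat_scheme \<Rightarrow> 'm set" where
  "regular_arrows C = {f. monic C f \<and> epic C f}"

definition full_subcat :: "('o, 'm, 'z) cat_scheme \<Rightarrow> 'o set \<Rightarrow> ('o, 'm, 'z) cat_scheme" where
  "full_subcat C X = C\<lparr>Obj := X, Arr := {f \<in> Arr C. Dom C f \<in> X \<and> Cod C f \<in> X}\<rparr>"

definition is_functor ::
  "('o, 'm, 'z) cat_scheme \<Rightarrow> ('p, 'n, 'y) cat_scheme \<Rightarrow> ('o \<Rightarrow> 'p) \<Rightarrow> ('m \<Rightarrow> 'n) \<Rightarrow> bool" where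
  "is_functor C D Fo Fa \<longleftrightarrow>
    (\<forall>A \<in> Obj C. Fo A \<in> Obj D) \<and>
    (\<forall>A \<in> Obj C. \<forall>B \<in> Obj C. \<forall>f \<in> Hom C A B. Fa f \<in> Hom D (Fo A) (Fo B)) \<and>
    (\<forall>A \<in> Obj C. Fa (Ide C A) = Ide D (Fo A)) \<and>
    (\<forall>f \<in> Arr C. \<forall>g \<in> Arr C. Dom C g = Cod C f \<longrightarrow>
       Fa (g \<cdot>\<^bsub>C\<^esub> f) = Fa g \<cdot>\<^bsub>D\<^esub> Fa f)"

definition naturally_isomorphic ::
  "('o, 'm, 'z) cat_scheme \<Rightarrow> ('p, 'n, 'y) cat_scheme \<Rightarrow>
   ('o \<Rightarrow> 'p) \<Rightarrow> ('m \<Rightarrow> 'n) \<Rightarrow> ('o \<Rightarrow> 'p) \<Rightarrow> ('m \<Rightarrow> 'n) \<Rightarrow> bool" where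
  "naturally_isomorphic C D Fo Fa Go Ga \<longleftrightarrow>
    (\<exists>\<eta>. (\<forall>A \<in> Obj C. \<eta> A \<in> Hom D (Fo A) (Go A) \<and> is_iso D (\<eta> A)) \<and>
         (\<forall>f \<in> Arr C. Ga f \<cdot>\<^bsub>D\<^esub> \<eta> (Dom C f) = \<eta> (Cod C f) \<cdot>\<^bsub>D\<^esub> Fa f))"

definition equivalent_cats ::
  "('o, 'm, 'z) cat_scheme \<Rightarrow> ('p, 'n, 'y) cat_scheme \<Rightarrow> bool" where
  "equivalent_cats C D \<longleftrightarrow> category C \<and> category D \<and>
    (\<exists>Fo Fa Go Ga. is_functor C D Fo Fa \<and> is_functor D C Go Ga \<and>
       naturally_isomorphic C C (Go \<circ> Fo) (Ga \<circ> Fa) id id \<and>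
       naturally_isomorphic D D (Fo \<circ> Go) (Fa \<circ> Ga) id id)"

subsection \<open>Additive and Krull-Schmidt categories\<close>

definition hom_group :: "('o, 'm, 'z) precat_scheme \<Rightarrow> 'o \<Rightarrow> 'o \<Rightarrow> 'm monoid" where
  "hom_group C A B = \<lparr>carrier = Hom C A B, monoid.mult = Plus C, one = Null C A B\<rparr>"

definition neg :: "('o, 'm, 'z) precat_scheme \<Rightarrow> 'm \<Rightarrow> 'm" where
  "neg C f = inv\<^bsub>hom_group C (Dom C f) (Cod C f)\<^esub> f"

locale preadditive_category = category C
  for C :: "('o, 'm, 'z) precat_scheme" (structure) +
  assumes hom_comm_group: "\<lbrakk>A \<in> Obj C; B \<in> Obj C\<rbrakk> \<Longrightarrow> comm_group (hom_group C A B)"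
    and Cmp_Plus: "\<lbrakk>f \<in> Hom C A B; f' \<in> Hom C A B; g \<in> Hom C B D\<rbrakk>
      \<Longrightarrow> g \<cdot> Plus C f f' = Plus C (g \<cdot> f) (g \<cdot> f')"
    and Plus_Cmp: "\<lbrakk>f \<in> Hom C A B; g \<in> Hom C B D; g' \<in> Hom C B D\<rbrakk>
      \<Longrightarrow> Plus C g g' \<cdot> f = Plus C (g \<cdot> f) (g' \<cdot> f)"

text \<open>\<open>X\<close> is a direct sum (biproduct) of \<open>A 0, \<dots>, A (n - 1)\<close>, with
  injections \<open>i k\<close> and projections \<open>p k\<close>. The product in the multiplicatively
  written group \<open>hom_group C X X\<close> is the sum of the endomorphisms \<open>i k \<cdot> p k\<close>.
  For \<open>n = 0\<close> this says that \<open>X\<close> is a zero object.\<close>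

definition direct_sum :: "('o, 'm, 'z) precat_scheme \<Rightarrow> nat \<Rightarrow> (nat \<Rightarrow> 'o) \<Rightarrow> 'o \<Rightarrow> bool" where
  "direct_sum C n A X \<longleftrightarrow> X \<in> Obj C \<and> (\<forall>k<n. A k \<in> Obj C) \<and>
    (\<exists>i p. (\<forall>k<n. i k \<in> Hom C (A k) X \<and> p k \<in> Hom C X (A k)) \<and>
       (\<forall>j<n. \<forall>k<n. p j \<cdot>\<^bsub>C\<^esub> i k = (if j = k then Ide C (A j) else Null C (A k) (A j))) \<and>
       finprod (hom_group C X X) (\<lambda>k. i k \<cdot>\<^bsub>C\<^esub> p k) {..<n} = Ide C X)"

definition zero_object :: "('o, 'm, 'z) precat_scheme \<Rightarrow> 'o \<Rightarrow> bool" where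
  "zero_object C Z \<longleftrightarrow> Z \<in> Obj C \<and> Ide C Z = Null C Z Z"

locale additive_category = preadditive_category C
  for C :: "('o, 'm, 'z) precat_scheme" (structure) +
  assumes ex_direct_sum: "(\<And>k. k < n \<Longrightarrow> A k \<in> Obj C) \<Longrightarrow> \<exists>X. direct_sum C n A X"

definition end_ring :: "('o, 'm, 'z) precat_scheme \<Rightarrow> 'o \<Rightarrow> 'm ring" where
  "end_ring C A = \<lparr>carrier = Hom C A A, monoid.mult = Cmp C, one = Ide C A,
     zero = Null C A A, add = Plus C\<rparr>"

text \<open>Not necessarily commutative local rings: the non-units are proper and closed under sums.\<close>

definition local_ring :: "('a, 'b) ring_scheme \<Rightarrow> bool" where
  "local_ring R \<longleftrightarrow> ring R \<and> \<one>\<^bsub>R\<^esub> \<noteq> \<zero>\<^bsub>R\<^esub> \<and>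
    (\<forall>x \<in> carrier R - Units R. \<forall>y \<in> carrier R - Units R. x \<oplus>\<^bsub>R\<^esub> y \<notin> Units R)"

definition krull_schmidt :: "('o, 'm, 'z) precat_scheme \<Rightarrow> bool" where
  "krull_schmidt C \<longleftrightarrow> additive_category C \<and>
    (\<forall>X \<in> Obj C. \<exists>n A. direct_sum C n A X \<and> (\<forall>k<n. local_ring (end_ring C (A k))))"

subsection \<open>Quotients by the ideal of morphisms factoring through a class of objects\<close>

definition factoring :: "('o, 'm, 'z) cat_scheme \<Rightarrow> 'o set \<Rightarrow> 'm set" where
  "factoring C W = {f \<in> Arr C. \<exists>X \<in> W. \<exists>g \<in> Hom C (Dom C f) X. \<exists>h \<in> Hom C X (Cod C f).
     f = h \<cdot>\<^bsub>C\<^esub> g}"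

definition ideal_class :: "('o, 'm, 'z) precat_scheme \<Rightarrow> 'o set \<Rightarrow> 'm \<Rightarrow> 'm set" where
  "ideal_class C W f = {g \<in> Hom C (Dom C f) (Cod C f). Plus C g (neg C f) \<in> factoring C W}"

text \<open>The category \<open>C/[W]\<close>: arrows are the congruence classes, and domain, codomain
  and composition are computed on representatives.\<close>

definition quotient_cat ::
  "('o, 'm, 'z) precat_scheme \<Rightarrow> 'o set \<Rightarrow> ('o, 'm set) cat" where
  "quotient_cat C W =
    \<lparr>Obj = Obj C,
     Arr = ideal_class C W ` Arr C,
     Dom = (\<lambda>c. Dom C (SOME f. f \<in> c)),
     Cod = (\<lambda>c. Cod C (SOME f. f \<in> c)),
     Ide = (\<lambda>A. ideal_class C W (Ide C A)),
     Cmp = (\<lambda>d c. ideal_class C W ((SOME g. g \<in> d) \<cdot>\<^bsub>C\<^esub> (SOME f. f \<in> c)))\<rparr>"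

subsection \<open>Gabriel-Zisman localisation\<close>

text \<open>Arrows of the localisation at \<open>R\<close> are paths in the graph with an edge
  \<open>Fwd f : A \<rightarrow> B\<close> for each arrow \<open>f : A \<rightarrow> B\<close> and an edge
  \<open>Bwd r : B \<rightarrow> A\<close> for each \<open>r : A \<rightarrow> B\<close> in \<open>R\<close>,
  modulo the least congruence making \<open>Fwd\<close> functorial and \<open>Bwd r\<close> a two-sided
  inverse of \<open>Fwd r\<close>. Paths are listed from source to target.\<close>

datatype 'm edge = Fwd 'm | Bwd 'm

inductive path :: "('o, 'm, 'z) cat_scheme \<Rightarrow> 'm set \<Rightarrow> 'o \<Rightarrow> 'm edge list \<Rightarrow> 'o \<Rightarrow> bool"
  for C R where
  path_Nil: "A \<in> Obj C \<Longrightarrow> path C R A [] A"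
| path_Fwd: "\<lbrakk>f \<in> Hom C A B; path C R B p D\<rbrakk> \<Longrightarrow> path C R A (Fwd f # p) D"
| path_Bwd: "\<lbrakk>r \<in> R; r \<in> Hom C A B; path C R A p D\<rbrakk> \<Longrightarrow> path C R B (Bwd r # p) D"

inductive path_eq ::
  "('o, 'm, 'z) cat_scheme \<Rightarrow> 'm set \<Rightarrow> 'o \<Rightarrow> 'o \<Rightarrow> 'm edge list \<Rightarrow> 'm edge list \<Rightarrow> bool"
  for C R where
  pe_refl: "path C R A p B \<Longrightarrow> path_eq C R A B p p"
| pe_sym: "path_eq C R A B p q \<Longrightarrow> path_eq C R A B q p"
| pe_trans: "\<lbrakk>path_eq C R A B p q; path_eq C R A B q r\<rbrakk> \<Longrightarrow> path_eq C R A B p r"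
| pe_append: "\<lbrakk>path_eq C R A B p p'; path_eq C R B D q q'\<rbrakk>
    \<Longrightarrow> path_eq C R A D (p @ q) (p' @ q')"
| pe_Ide: "A \<in> Obj C \<Longrightarrow> path_eq C R A A [Fwd (Ide C A)] []"
| pe_Cmp: "\<lbrakk>f \<in> Hom C A B; g \<in> Hom C B D\<rbrakk>
    \<Longrightarrow> path_eq C R A D [Fwd f, Fwd g] [Fwd (g \<cdot>\<^bsub>C\<^esub> f)]"
| pe_Fwd_Bwd: "\<lbrakk>r \<in> R; r \<in> Hom C A B\<rbrakk> \<Longrightarrow> path_eq C R A A [Fwd r, Bwd r] []"
| pe_Bwd_Fwd: "\<lbrakk>r \<in> R; r \<in> Hom C A B\<rbrakk> \<Longrightarrow> path_eq C R B B [Bwd r, Fwd r] []"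

definition path_class ::
  "('o, 'm, 'z) cat_scheme \<Rightarrow> 'm set \<Rightarrow> 'o \<Rightarrow> 'm edge list \<Rightarrow> 'o \<Rightarrow> ('o \<times> 'm edge list \<times> 'o) set" where
  "path_class C R A p B = {(A, q, B) | q. path_eq C R A B p q}"

definition localisation ::
  "('o, 'm, 'z) cat_scheme \<Rightarrow> 'm set \<Rightarrow> ('o, ('o \<times> 'm edge list \<times> 'o) set) cat" where
  "localisation C R =
    \<lparr>Obj = Obj C,
     Arr = {path_class C R A p B | A p B. path C R A p B},
     Dom = (\<lambda>c. fst (SOME t. t \<in> c)),
     Cod = (\<lambda>c. snd (snd (SOME t. t \<in> c))),
     Ide = (\<lambda>A. path_class C R A [] A),
     Cmp = (\<lambda>d c. case (SOME t. t \<in> c, SOME t. t \<in> d) of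
       ((A, p, _), (_, q, D)) \<Rightarrow> path_class C R A (p @ q) D)\<rparr>"

subsection \<open>Triangulated categories\<close>

text \<open>The suspension is an additive automorphism of \<open>C\<close>.\<close>

locale triangulated_category = additive_category C
  for C :: "('o, 'm, 'z) tricat_scheme" (structure) +
  assumes Susp_functor: "is_functor C C (SuspO C) (SuspA C)"
    and SuspO_bij: "bij_betw (SuspO C) (Obj C) (Obj C)"
    and SuspA_bij: "bij_betw (SuspA C) (Arr C) (Arr C)"
    and SuspA_Plus: "\<lbrakk>f \<in> Hom C A B; g \<in> Hom C A B\<rbrakk>
      \<Longrightarrow> SuspA C (Plus C f g) = Plus C (SuspA C f) (SuspA C g)"
    and Tri_Arr: "(u, v, w) \<in> Tri C \<Longrightarrow>
      \<exists>X Y Z. u \<in> Hom C X Y \<and> v \<in> Hom C Y Z \<and> w \<in> Hom C Z (SuspO C X)"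
    and TR1_Ide: "\<lbrakk>X \<in> Obj C; zero_object C Z\<rbrakk>
      \<Longrightarrow> (Ide C X, Null C X Z, Null C Z (SuspO C X)) \<in> Tri C"
    and TR1_cone: "u \<in> Arr C \<Longrightarrow> \<exists>v w. (u, v, w) \<in> Tri C"
    and TR1_iso: "\<lbrakk>(u, v, w) \<in> Tri C;
        u \<in> Hom C X Y; v \<in> Hom C Y Z; w \<in> Hom C Z (SuspO C X);
        u' \<in> Hom C X' Y'; v' \<in> Hom C Y' Z'; w' \<in> Hom C Z' (SuspO C X');
        a \<in> Hom C X X'; b \<in> Hom C Y Y'; c \<in> Hom C Z Z';
        is_iso C a; is_iso C b; is_iso C c;
        b \<cdot> u = u' \<cdot> a; c \<cdot> v = v' \<cdot> b; SuspA C a \<cdot> w = w' \<cdot> c\<rbrakk>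
      \<Longrightarrow> (u', v', w') \<in> Tri C"
    and TR2: "\<lbrakk>u \<in> Hom C X Y; v \<in> Hom C Y Z; w \<in> Hom C Z (SuspO C X)\<rbrakk>
      \<Longrightarrow> (u, v, w) \<in> Tri C \<longleftrightarrow> (v, w, neg C (SuspA C u)) \<in> Tri C"
    and TR3: "\<lbrakk>(u, v, w) \<in> Tri C; (u', v', w') \<in> Tri C;
        a \<in> Hom C (Dom C u) (Dom C u'); b \<in> Hom C (Cod C u) (Cod C u'); b \<cdot> u = u' \<cdot> a\<rbrakk>
      \<Longrightarrow> \<exists>c \<in> Hom C (Cod C v) (Cod C v'). c \<cdot> v = v' \<cdot> b \<and> SuspA C a \<cdot> w = w' \<cdot> c"
    and TR4: "\<lbrakk>u \<in> Hom C X Y; v \<in> Hom C Y Z;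
        (u, i, i') \<in> Tri C; (v, j, j') \<in> Tri C; (v \<cdot> u, k, k') \<in> Tri C\<rbrakk>
      \<Longrightarrow> \<exists>f \<in> Hom C (Cod C i) (Cod C k). \<exists>g \<in> Hom C (Cod C k) (Cod C j).
            (f, g, SuspA C i \<cdot> j') \<in> Tri C \<and>
            f \<cdot> i = k \<cdot> v \<and> k' \<cdot> f = i' \<and> g \<cdot> k = j \<and> j' \<cdot> g = SuspA C u \<cdot> k'"

subsection \<open>Cotorsion pairs and hearts\<close>

text \<open>Full subcategories are represented by their sets of objects.\<close>

definition ext_vanish :: "('o, 'm, 'z) tricat_scheme \<Rightarrow> 'o set \<Rightarrow> 'o set \<Rightarrow> bool" where
  "ext_vanish C X Y \<longleftrightarrow>
    (\<forall>A \<in> X. \<forall>B \<in> Y. Hom C A (SuspO C B) = {Null C A (SuspO C B)})"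

definition star :: "('o, 'm, 'z) tricat_scheme \<Rightarrow> 'o set \<Rightarrow> 'o set \<Rightarrow> 'o set" where
  "star C X Y = {E \<in> Obj C. \<exists>u v w. (u, v, w) \<in> Tri C \<and> Dom C u \<in> X \<and> Cod C u = E \<and> Cod C v \<in> Y}"

definition Susp :: "('o, 'm, 'z) tricat_scheme \<Rightarrow> 'o set \<Rightarrow> 'o set" where
  "Susp C X = SuspO C ` X"

text \<open>\<open>SuspO C\<close> is bijective on objects, so the inverse image is the image
  under the inverse suspension.\<close>

definition Desusp :: "('o, 'm, 'z) tricat_scheme \<Rightarrow> 'o set \<Rightarrow> 'o set" where
  "Desusp C X = {A \<in> Obj C. SuspO C A \<in> X}"

definition additive_subcat :: "('o, 'm, 'z) precat_scheme \<Rightarrow> 'o set \<Rightarrow> bool" where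
  "additive_subcat C X \<longleftrightarrow> X \<subseteq> Obj C \<and>
    (\<forall>n A E. (\<forall>k<n. A k \<in> X) \<and> direct_sum C n A E \<longrightarrow> E \<in> X)"

definition iso_closed :: "('o, 'm, 'z) cat_scheme \<Rightarrow> 'o set \<Rightarrow> bool" where
  "iso_closed C X \<longleftrightarrow> (\<forall>f. is_iso C f \<and> Dom C f \<in> X \<longrightarrow> Cod C f \<in> X)"

definition summand_closed :: "('o, 'm, 'z) precat_scheme \<Rightarrow> 'o set \<Rightarrow> bool" where
  "summand_closed C X \<longleftrightarrow>
    (\<forall>n A E. E \<in> X \<and> direct_sum C n A E \<longrightarrow> (\<forall>k<n. A k \<in> X))"

definition cotorsion_pair :: "('o, 'm, 'z) tricat_scheme \<Rightarrow> 'o set \<Rightarrow> 'o set \<Rightarrow> bool" where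
  "cotorsion_pair C U V \<longleftrightarrow>
    additive_subcat C U \<and> iso_closed C U \<and> summand_closed C U \<and>
    additive_subcat C V \<and> iso_closed C V \<and> summand_closed C V \<and>
    ext_vanish C U V \<and> Obj C = star C U (Susp C V)"

definition twin_cotorsion_pair ::
  "('o, 'm, 'z) tricat_scheme \<Rightarrow> 'o set \<Rightarrow> 'o set \<Rightarrow> 'o set \<Rightarrow> 'o set \<Rightarrow> bool" where
  "twin_cotorsion_pair C S T U V \<longleftrightarrow>
    cotorsion_pair C S T \<and> cotorsion_pair C U V \<and> ext_vanish C S V"

definition twin_heart ::
  "('o, 'm, 'z) tricat_scheme \<Rightarrow> 'o set \<Rightarrow> 'o set \<Rightarrow> 'o set \<Rightarrow> 'o set \<Rightarrow> ('o, 'm set) cat" where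
  "twin_heart C S T U V =
    (let W = T \<inter> U; Cminus = star C (Desusp C S) W; Cplus = star C W (Susp C V)
     in quotient_cat (full_subcat C (Cminus \<inter> Cplus)) W)"

definition heart :: "('o, 'm, 'z) tricat_scheme \<Rightarrow> 'o set \<Rightarrow> 'o set \<Rightarrow> ('o, 'm set) cat" where
  "heart C S T =
    (let W = S \<inter> T; Cminus = star C (Desusp C S) W; Cplus = star C W (Susp C T)
     in quotient_cat (full_subcat C (Cminus \<inter> Cplus)) W)"

end

theory Submission
  imports Defs
begin

text \<open>
  Write \<open>\<P>\<close> for the class \<open>\<Sigma>\<^sup>-\<^sup>1S\<close>, whose objects are called probes. A probe has only zero maps to
  objects of \<open>T\<close>, and every object \<open>X\<close> lies in a triangle \<open>P \<rightarrow> X \<rightarrow> T' \<rightarrow> \<Sigma>P\<close> with \<open>P\<close> a probe and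
  \<open>T' \<in> T\<close>. Hence a morphism factors through \<open>T\<close> if and only if it kills every map from a probe, so
  the functors \<open>Hom(P, -)\<close> are jointly faithful on \<open>C/[T]\<close>, and this quotient is the heart of the twin
  cotorsion pair when \<open>T = U\<close>. Applying this to the cone of a morphism shows that \<open>f\<close> is regular in
  \<open>C/[T]\<close> if and only if \<open>Hom(P, f)\<close> is bijective for every probe \<open>P\<close> (\<open>regular_iff\<close>).

  The heart of \<open>(S, T)\<close> lives on \<open>L = \<P> * S\<close>. On morphisms leaving an object of \<open>L\<close> the ideals \<open>[S]\<close> and
  \<open>[T]\<close> coincide, because both consist of the morphisms that kill the probes; so this heart is the full
  subcategory of \<open>C/[T]\<close> on \<open>L\<close> (\<open>full_subcategory_of_quot\<close>).

  An object of \<open>L\<close> is in \<open>C/[T]\<close> the cokernel of a map between probes, so regular morphisms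
  induce bijections on morphisms out of it (\<open>colocal_extensions\<close>). Conversely, the octahedral axiom
  provides for every \<open>X\<close> a regular morphism \<open>A \<rightarrow> X\<close> with \<open>A \<in> L\<close> (\<open>ex_coreflection\<close>). Thus \<open>L\<close> is a
  coreflective subcategory whose coreflections are inverted, while the inverted morphisms are invisible to
  \<open>L\<close>; in this situation the localisation is equivalent to the subcategory
  (\<open>localisation_equivalent_colocal_subcategory\<close>).
\<close>

section \<open>Categories and equivalences\<close>

lemma Hom_Dom: "f \<in> Hom C A B \<Longrightarrow> Dom C f = A"
  and Hom_Cod: "f \<in> Hom C A B \<Longrightarrow> Cod C f = B"
  and Hom_Arr: "f \<in> Hom C A B \<Longrightarrow> f \<in> Arr C"
  by (simp_all add: Hom_def)

lemma Arr_Hom: "f \<in> Arr C \<Longrightarrow> f \<in> Hom C (Dom C f) (Cod C f)"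
  by (simp add: Hom_def)

lemma (in category) Hom_Obj:
  assumes "f \<in> Hom C A B" shows "A \<in> Obj C" "B \<in> Obj C"
  using assms Dom_closed Cod_closed by (auto simp: Hom_def)

lemma equivalent_cats_sym: "equivalent_cats C D \<Longrightarrow> equivalent_cats D C"
  unfolding equivalent_cats_def by blast

lemma is_functor_Hom:
  "\<lbrakk>is_functor C D Fo Fa; category C; f \<in> Hom C A B\<rbrakk> \<Longrightarrow> Fa f \<in> Hom D (Fo A) (Fo B)"
  unfolding is_functor_def using category.Hom_Obj by metis

lemma is_functor_Cmp:
  "\<lbrakk>is_functor C D Fo Fa; f \<in> Hom C A B; g \<in> Hom C B E\<rbrakk>
    \<Longrightarrow> Fa (g \<cdot>\<^bsub>C\<^esub> f) = Fa g \<cdot>\<^bsub>D\<^esub> Fa f"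
  unfolding is_functor_def Hom_def by auto

lemma is_isoI:
  assumes "f \<in> Hom C A B" "g \<in> Hom C B A"
    "g \<cdot>\<^bsub>C\<^esub> f = Ide C A" "f \<cdot>\<^bsub>C\<^esub> g = Ide C B"
  shows "is_iso C f"
  using assms by (auto simp: is_iso_def Hom_def)

lemma fully_faithful_essentially_surjective_equivalence:
  fixes C :: "('o, 'm, 'z) cat_scheme" and D :: "('p, 'n, 'y) cat_scheme"
  assumes C: "category C" and D: "category D" and F: "is_functor C D Fo Fa"
    and ff: "\<And>A B. \<lbrakk>A \<in> Obj C; B \<in> Obj C\<rbrakk>
      \<Longrightarrow> bij_betw Fa (Hom C A B) (Hom D (Fo A) (Fo B))"
    and es: "\<And>Y. Y \<in> Obj D \<Longrightarrow> \<exists>A \<in> Obj C. \<exists>e \<in> Hom D (Fo A) Y. is_iso D e"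
  shows "equivalent_cats C D"
proof -
  interpret C: category C by (rule C)
  interpret D: category D by (rule D)
  have "\<exists>A e e'. A \<in> Obj C \<and> e \<in> Hom D (Fo A) Y \<and> e' \<in> Hom D Y (Fo A) \<and>
      e' \<cdot>\<^bsub>D\<^esub> e = Ide D (Fo A) \<and> e \<cdot>\<^bsub>D\<^esub> e' = Ide D Y" if "Y \<in> Obj D" for Y
    using es[OF that] by (metis Hom_Dom Hom_Cod is_iso_def)
  then obtain K e e' where K: "\<And>Y. Y \<in> Obj D \<Longrightarrow> K Y \<in> Obj C"
    and e: "\<And>Y. Y \<in> Obj D \<Longrightarrow> e Y \<in> Hom D (Fo (K Y)) Y"
    and e': "\<And>Y. Y \<in> Obj D \<Longrightarrow> e' Y \<in> Hom D Y (Fo (K Y))"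
    and e'e: "\<And>Y. Y \<in> Obj D \<Longrightarrow> e' Y \<cdot>\<^bsub>D\<^esub> e Y = Ide D (Fo (K Y))"
    and ee': "\<And>Y. Y \<in> Obj D \<Longrightarrow> e Y \<cdot>\<^bsub>D\<^esub> e' Y = Ide D Y"
    by metis
  have FoO: "Fo A \<in> Obj D" if "A \<in> Obj C" for A
    using F that by (auto simp: is_functor_def)
  have FaH: "Fa f \<in> Hom D (Fo A) (Fo B)" if "f \<in> Hom C A B" for f A B
    by (rule is_functor_Hom[OF F C that])
  have FaI: "Fa (Ide C A) = Ide D (Fo A)" if "A \<in> Obj C" for A
    using F that by (auto simp: is_functor_def)
  have FaC: "Fa (g \<cdot>\<^bsub>C\<^esub> f) = Fa g \<cdot>\<^bsub>D\<^esub> Fa f"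
    if "f \<in> Hom C A B" "g \<in> Hom C B E" for f g A B E
    by (rule is_functor_Cmp[OF F that])
  have inj: "f = g" if "f \<in> Hom C A B" "g \<in> Hom C A B" "Fa f = Fa g" for f g A B
    using ff[of A B] C.Hom_Obj[OF that(1)] that by (auto simp: bij_betw_def inj_on_def)
  define lift where "lift A B = inv_into (Hom C A B) Fa" for A B
  have lift: "lift A B h \<in> Hom C A B" "Fa (lift A B h) = h"
    if "A \<in> Obj C" "B \<in> Obj C" "h \<in> Hom D (Fo A) (Fo B)" for A B h
    using ff[OF that(1,2)] that(3)
    by (auto simp: lift_def bij_betw_def intro: inv_into_into f_inv_into_f)
  define Ga where "Ga g = lift (K (Dom D g)) (K (Cod D g))
      (e' (Cod D g) \<cdot>\<^bsub>D\<^esub> (g \<cdot>\<^bsub>D\<^esub> e (Dom D g)))" for g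
  have Ga: "Ga g \<in> Hom C (K Y) (K Z)" "Fa (Ga g) = e' Z \<cdot>\<^bsub>D\<^esub> (g \<cdot>\<^bsub>D\<^esub> e Y)"
    if g: "g \<in> Hom D Y Z" for g Y Z
  proof -
    have YZ: "Y \<in> Obj D" "Z \<in> Obj D" using D.Hom_Obj[OF g] by auto
    have "e' Z \<cdot>\<^bsub>D\<^esub> (g \<cdot>\<^bsub>D\<^esub> e Y) \<in> Hom D (Fo (K Y)) (Fo (K Z))"
      using e e' g YZ by (meson D.Cmp_Hom)
    from lift[OF K[OF YZ(1)] K[OF YZ(2)] this]
    show "Ga g \<in> Hom C (K Y) (K Z)" "Fa (Ga g) = e' Z \<cdot>\<^bsub>D\<^esub> (g \<cdot>\<^bsub>D\<^esub> e Y)"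
      by (simp_all add: Ga_def Hom_Dom[OF g] Hom_Cod[OF g])
  qed
  have nat_e: "e Z \<cdot>\<^bsub>D\<^esub> Fa (Ga g) = g \<cdot>\<^bsub>D\<^esub> e Y" if g: "g \<in> Hom D Y Z" for g Y Z
  proof -
    have YZ: "Y \<in> Obj D" "Z \<in> Obj D" using D.Hom_Obj[OF g] by auto
    have ge: "g \<cdot>\<^bsub>D\<^esub> e Y \<in> Hom D (Fo (K Y)) Z" using D.Cmp_Hom e g YZ by blast
    have "e Z \<cdot>\<^bsub>D\<^esub> Fa (Ga g) = (e Z \<cdot>\<^bsub>D\<^esub> e' Z) \<cdot>\<^bsub>D\<^esub> (g \<cdot>\<^bsub>D\<^esub> e Y)"
      using D.Cmp_assoc[OF ge e'[OF YZ(2)] e[OF YZ(2)]] Ga(2)[OF g] by simp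
    also have "\<dots> = g \<cdot>\<^bsub>D\<^esub> e Y" using ee'[OF YZ(2)] D.Ide_Cmp[OF ge] by simp
    finally show ?thesis .
  qed
  have e_cancel: "h = k" if "Z \<in> Obj D" "h \<in> Hom D X (Fo (K Z))" "k \<in> Hom D X (Fo (K Z))"
    "e Z \<cdot>\<^bsub>D\<^esub> h = e Z \<cdot>\<^bsub>D\<^esub> k" for X Z h k
    using D.Cmp_assoc[OF that(2) e[OF that(1)] e'[OF that(1)]]
      D.Cmp_assoc[OF that(3) e[OF that(1)] e'[OF that(1)]]
      e'e[OF that(1)] D.Ide_Cmp[OF that(2)] D.Ide_Cmp[OF that(3)] that(4) by simp
  have G: "is_functor D C K Ga"
    unfolding is_functor_def
  proof (intro conjI ballI impI)
    fix Y assume Y: "Y \<in> Obj D"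
    show "K Y \<in> Obj C" by (rule K[OF Y])
    have "Fa (Ga (Ide D Y)) = Fa (Ide C (K Y))"
      using Ga(2)[OF D.Ide_Hom[OF Y]] D.Ide_Cmp[OF e[OF Y]] e'e[OF Y] FaI[OF K[OF Y]] by simp
    then show "Ga (Ide D Y) = Ide C (K Y)"
      using inj Ga(1)[OF D.Ide_Hom[OF Y]] C.Ide_Hom[OF K[OF Y]] by blast
  next
    fix Y Z g assume "g \<in> Hom D Y Z"
    then show "Ga g \<in> Hom C (K Y) (K Z)" by (rule Ga)
  next
    fix f g assume "f \<in> Arr D" "g \<in> Arr D" "Dom D g = Cod D f"
    then obtain X Y Z where f: "f \<in> Hom D X Y" and g: "g \<in> Hom D Y Z"
      by (auto simp: Hom_def)
    have gf: "g \<cdot>\<^bsub>D\<^esub> f \<in> Hom D X Z" by (rule D.Cmp_Hom[OF f g])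
    have O: "X \<in> Obj D" "Y \<in> Obj D" "Z \<in> Obj D"
      using D.Hom_Obj[OF f] D.Hom_Obj[OF g] by auto
    note Ff = FaH[OF Ga(1)[OF f]] and Fg = FaH[OF Ga(1)[OF g]]
    have "e Z \<cdot>\<^bsub>D\<^esub> (Fa (Ga g) \<cdot>\<^bsub>D\<^esub> Fa (Ga f)) = (g \<cdot>\<^bsub>D\<^esub> e Y) \<cdot>\<^bsub>D\<^esub> Fa (Ga f)"
      using D.Cmp_assoc[OF Ff Fg e[OF O(3)]] nat_e[OF g] by simp
    also have "\<dots> = g \<cdot>\<^bsub>D\<^esub> (f \<cdot>\<^bsub>D\<^esub> e X)"
      using D.Cmp_assoc[OF Ff e[OF O(2)] g] nat_e[OF f] by simp
    also have "\<dots> = e Z \<cdot>\<^bsub>D\<^esub> Fa (Ga (g \<cdot>\<^bsub>D\<^esub> f))"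
      using D.Cmp_assoc[OF e[OF O(1)] f g] nat_e[OF gf] by simp
    finally have "Fa (Ga g) \<cdot>\<^bsub>D\<^esub> Fa (Ga f) = Fa (Ga (g \<cdot>\<^bsub>D\<^esub> f))"
      using e_cancel[OF O(3) D.Cmp_Hom[OF Ff Fg] FaH[OF Ga(1)[OF gf]]] by blast
    then show "Ga (g \<cdot>\<^bsub>D\<^esub> f) = Ga g \<cdot>\<^bsub>C\<^esub> Ga f"
      using inj[OF Ga(1)[OF gf] C.Cmp_Hom[OF Ga(1)[OF f] Ga(1)[OF g]]]
        FaC[OF Ga(1)[OF f] Ga(1)[OF g]] by simp
  qed
  have FG: "naturally_isomorphic D D (Fo \<circ> K) (Fa \<circ> Ga) id id"
    unfolding naturally_isomorphic_def
  proof (intro exI[of _ e] conjI ballI)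
    fix Y assume Y: "Y \<in> Obj D"
    show "e Y \<in> Hom D ((Fo \<circ> K) Y) (id Y)" using e[OF Y] by simp
    show "is_iso D (e Y)" by (rule is_isoI[OF e[OF Y] e'[OF Y] e'e[OF Y] ee'[OF Y]])
  next
    fix g assume "g \<in> Arr D"
    then show "id g \<cdot>\<^bsub>D\<^esub> e (Dom D g) = e (Cod D g) \<cdot>\<^bsub>D\<^esub> (Fa \<circ> Ga) g"
      using nat_e[OF Arr_Hom] by simp
  qed
  have GF: "naturally_isomorphic C C (K \<circ> Fo) (Ga \<circ> Fa) id id"
    unfolding naturally_isomorphic_def
  proof (intro exI[of _ "\<lambda>A. lift (K (Fo A)) A (e (Fo A))"] conjI ballI)
    fix A assume A: "A \<in> Obj C"
    note B = FoO[OF A]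
    note h = lift[OF K[OF B] A e[OF B]] and h' = lift[OF A K[OF B] e'[OF B]]
    show "lift (K (Fo A)) A (e (Fo A)) \<in> Hom C ((K \<circ> Fo) A) (id A)" using h by simp
    show "is_iso C (lift (K (Fo A)) A (e (Fo A)))"
    proof (rule is_isoI[OF h(1) h'(1)])
      show "lift A (K (Fo A)) (e' (Fo A)) \<cdot>\<^bsub>C\<^esub> lift (K (Fo A)) A (e (Fo A)) = Ide C (K (Fo A))"
        using inj[OF C.Cmp_Hom[OF h(1) h'(1)] C.Ide_Hom[OF K[OF B]]]
          FaC[OF h(1) h'(1)] h(2) h'(2) e'e[OF B] FaI[OF K[OF B]] by simp
      show "lift (K (Fo A)) A (e (Fo A)) \<cdot>\<^bsub>C\<^esub> lift A (K (Fo A)) (e' (Fo A)) = Ide C A"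
        using inj[OF C.Cmp_Hom[OF h'(1) h(1)] C.Ide_Hom[OF A]]
          FaC[OF h'(1) h(1)] h(2) h'(2) ee'[OF B] FaI[OF A] by simp
    qed
  next
    fix f assume "f \<in> Arr C"
    then obtain A B where f: "f \<in> Hom C A B" using Arr_Hom by metis
    have O: "A \<in> Obj C" "B \<in> Obj C" using C.Hom_Obj[OF f] by auto
    note FO = FoO[OF O(1)] FoO[OF O(2)]
    note hA = lift[OF K[OF FO(1)] O(1) e[OF FO(1)]]
      and hB = lift[OF K[OF FO(2)] O(2) e[OF FO(2)]]
    note GFf = Ga[OF FaH[OF f]]
    have "f \<cdot>\<^bsub>C\<^esub> lift (K (Fo A)) A (e (Fo A)) = lift (K (Fo B)) B (e (Fo B)) \<cdot>\<^bsub>C\<^esub> Ga (Fa f)"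
      using inj[OF C.Cmp_Hom[OF hA(1) f] C.Cmp_Hom[OF GFf(1) hB(1)]]
        FaC[OF hA(1) f] FaC[OF GFf(1) hB(1)] hA(2) hB(2) nat_e[OF FaH[OF f]] by simp
    then show "id f \<cdot>\<^bsub>C\<^esub> lift (K (Fo (Dom C f))) (Dom C f) (e (Fo (Dom C f)))
        = lift (K (Fo (Cod C f))) (Cod C f) (e (Fo (Cod C f))) \<cdot>\<^bsub>C\<^esub> (Ga \<circ> Fa) f"
      by (simp add: Hom_Dom[OF f] Hom_Cod[OF f])
  qed
  show ?thesis
    unfolding equivalent_cats_def using C D F G GF FG by blast
qed

text \<open>Composition is compared only on composable pairs, since its values elsewhere carry no meaning
  and differ between two constructions of the same category.\<close>

definition full_subcategory_of ::
  "('o, 'm, 'z) cat_scheme \<Rightarrow> ('o, 'm, 'y) cat_scheme \<Rightarrow> bool" where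
  "full_subcategory_of E D \<longleftrightarrow> Obj E \<subseteq> Obj D \<and>
    (\<forall>f \<in> Arr E. Dom E f \<in> Obj E \<and> Cod E f \<in> Obj E) \<and>
    (\<forall>A \<in> Obj E. \<forall>B \<in> Obj E. Hom E A B = Hom D A B) \<and>
    (\<forall>A \<in> Obj E. Ide E A = Ide D A) \<and>
    (\<forall>A \<in> Obj E. \<forall>B \<in> Obj E. \<forall>X \<in> Obj E. \<forall>f \<in> Hom D A B. \<forall>g \<in> Hom D B X.
       g \<cdot>\<^bsub>E\<^esub> f = g \<cdot>\<^bsub>D\<^esub> f)"

lemma full_subcategory_of_category:
  assumes "full_subcategory_of E D" and "category D"
  shows "category E"
proof -
  interpret D: category D by fact
  have sub: "Obj E \<subseteq> Obj D"
    and DC: "\<And>f. f \<in> Arr E \<Longrightarrow> Dom E f \<in> Obj E \<and> Cod E f \<in> Obj E"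
    and H: "\<And>A B. \<lbrakk>A \<in> Obj E; B \<in> Obj E\<rbrakk> \<Longrightarrow> Hom E A B = Hom D A B"
    and I: "\<And>A. A \<in> Obj E \<Longrightarrow> Ide E A = Ide D A"
    and Cm: "\<And>A B X f g. \<lbrakk>A \<in> Obj E; B \<in> Obj E; X \<in> Obj E; f \<in> Hom D A B; g \<in> Hom D B X\<rbrakk>
       \<Longrightarrow> g \<cdot>\<^bsub>E\<^esub> f = g \<cdot>\<^bsub>D\<^esub> f"
    using assms(1) unfolding full_subcategory_of_def by blast+
  have O: "A \<in> Obj E \<and> B \<in> Obj E \<and> f \<in> Hom D A B" if "f \<in> Hom E A B" for f A B
    using that DC H by (metis Hom_Arr Hom_Dom Hom_Cod)
  show ?thesis
  proof
    fix f assume "f \<in> Arr E"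
    then show "Dom E f \<in> Obj E" "Cod E f \<in> Obj E" using DC by auto
  next
    fix A assume "A \<in> Obj E"
    then show "Ide E A \<in> Hom E A A" using H I sub D.Ide_Hom by auto
  next
    fix f g A B X assume f: "f \<in> Hom E A B" and g: "g \<in> Hom E B X"
    show "g \<cdot>\<^bsub>E\<^esub> f \<in> Hom E A X"
      using O[OF f] O[OF g] H[of A X] Cm[of A B X f g] D.Cmp_Hom[of f A B g X] by simp
  next
    fix f A B assume f: "f \<in> Hom E A B"
    show "f \<cdot>\<^bsub>E\<^esub> Ide E A = f"
      using O[OF f] Cm[of A A B "Ide D A" f] I[of A] D.Ide_Hom[of A] D.Cmp_Ide[of f A B] sub by auto
    show "Ide E B \<cdot>\<^bsub>E\<^esub> f = f"
      using O[OF f] Cm[of A B B f "Ide D B"] I[of B] D.Ide_Hom[of B] D.Ide_Cmp[of f A B] sub by auto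
  next
    fix f g h A B X Y assume f: "f \<in> Hom E A B" and g: "g \<in> Hom E B X" and h: "h \<in> Hom E X Y"
    note O' = O[OF f] O[OF g] O[OF h]
    have "(h \<cdot>\<^bsub>E\<^esub> g) \<cdot>\<^bsub>E\<^esub> f = (h \<cdot>\<^bsub>D\<^esub> g) \<cdot>\<^bsub>D\<^esub> f"
      using O' Cm[of B X Y g h] Cm[of A B Y f "h \<cdot>\<^bsub>D\<^esub> g"] D.Cmp_Hom[of g B X h Y] by simp
    moreover have "h \<cdot>\<^bsub>E\<^esub> (g \<cdot>\<^bsub>E\<^esub> f) = h \<cdot>\<^bsub>D\<^esub> (g \<cdot>\<^bsub>D\<^esub> f)"
      using O' Cm[of A B X f g] Cm[of A X Y "g \<cdot>\<^bsub>D\<^esub> f" h] D.Cmp_Hom[of f A B g X] by simp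
    ultimately show "(h \<cdot>\<^bsub>E\<^esub> g) \<cdot>\<^bsub>E\<^esub> f = h \<cdot>\<^bsub>E\<^esub> (g \<cdot>\<^bsub>E\<^esub> f)"
      using O' D.Cmp_assoc[of f A B g X h Y] by simp
  qed
qed

section \<open>Localisation at arrows seen as invertible by a full subcategory\<close>

context category
begin

lemma path_Obj: "path C R A p B \<Longrightarrow> A \<in> Obj C \<and> B \<in> Obj C"
  by (induction rule: path.induct) (auto dest: Hom_Obj)

lemma path_append: "\<lbrakk>path C R A p B; path C R B q D\<rbrakk> \<Longrightarrow> path C R A (p @ q) D"
  by (induction rule: path.induct) (auto intro: path.intros)

lemma path_single: "f \<in> Hom C A B \<Longrightarrow> path C R A [Fwd f] B"
  by (meson Hom_Obj path.intros)

lemma path_eq_path: "path_eq C R A B p q \<Longrightarrow> path C R A p B \<and> path C R A q B"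
proof (induction rule: path_eq.induct)
  case (pe_Cmp f A B g D)
  then show ?case by (meson Cmp_Hom path_single path_Fwd)
next
  case (pe_Fwd_Bwd r A B)
  then show ?case by (meson Hom_Obj path.intros)
next
  case (pe_Bwd_Fwd r A B)
  then show ?case by (meson Hom_Obj path.intros)
next
  case (pe_append A B p p' D q q')
  then show ?case using path_append by blast
next
  case (pe_Ide A)
  then show ?case by (simp add: path_Nil path_single[OF Ide_Hom])
qed simp_all

lemma path_class_eqI: "path_eq C R A B p q \<Longrightarrow> path_class C R A p B = path_class C R A q B"
  unfolding path_class_def by (blast intro: pe_sym pe_trans)

lemma path_class_eq_iff:
  assumes "path C R A p B" "path C R A q B"
  shows "path_class C R A p B = path_class C R A q B \<longleftrightarrow> path_eq C R A B p q"
proof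
  assume "path_class C R A p B = path_class C R A q B"
  moreover have "(A, q, B) \<in> path_class C R A q B"
    using assms by (simp add: path_class_def pe_refl)
  ultimately have "(A, q, B) \<in> path_class C R A p B" by simp
  then show "path_eq C R A B p q" by (simp add: path_class_def)
next
  assume "path_eq C R A B p q"
  then show "path_class C R A p B = path_class C R A q B" by (rule path_class_eqI)
qed

lemma some_path_class:
  assumes "path C R A p B"
  obtains q where "(SOME t. t \<in> path_class C R A p B) = (A, q, B)" "path_eq C R A B p q"
proof -
  have "(A, p, B) \<in> path_class C R A p B"
    using assms by (simp add: path_class_def pe_refl)
  from someI[of "\<lambda>t. t \<in> path_class C R A p B", OF this] show ?thesis
    by (auto simp: path_class_def intro: that)
qed

lemma localisation_Dom_Cod:
  assumes "path C R A p B"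
  shows "Dom (localisation C R) (path_class C R A p B) = A"
    and "Cod (localisation C R) (path_class C R A p B) = B"
proof -
  obtain q where "(SOME t. t \<in> path_class C R A p B) = (A, q, B)"
    using some_path_class[OF assms] .
  then show "Dom (localisation C R) (path_class C R A p B) = A"
    "Cod (localisation C R) (path_class C R A p B) = B"
    by (simp_all add: localisation_def)
qed

lemma localisation_Hom:
  "Hom (localisation C R) A B = {path_class C R A p B | p. path C R A p B}"
proof (intro equalityI subsetI)
  fix c assume c: "c \<in> Hom (localisation C R) A B"
  then obtain A' p B' where p: "path C R A' p B'" "c = path_class C R A' p B'"
    by (auto simp: Hom_def localisation_def)
  then show "c \<in> {path_class C R A p B | p. path C R A p B}"
    using c localisation_Dom_Cod[OF p(1)] by (auto simp: Hom_def)
next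
  fix c assume "c \<in> {path_class C R A p B | p. path C R A p B}"
  then obtain p where p: "path C R A p B" "c = path_class C R A p B" by auto
  then have "c \<in> Arr (localisation C R)" by (auto simp: localisation_def)
  then show "c \<in> Hom (localisation C R) A B"
    using p localisation_Dom_Cod[OF p(1)] by (simp add: Hom_def)
qed

lemma localisation_Cmp:
  assumes "path C R A p B" "path C R B q D"
  shows "path_class C R B q D \<cdot>\<^bsub>localisation C R\<^esub> path_class C R A p B = path_class C R A (p @ q) D"
proof -
  obtain p' where p': "(SOME t. t \<in> path_class C R A p B) = (A, p', B)" "path_eq C R A B p p'"
    using some_path_class[OF assms(1)] .
  obtain q' where q': "(SOME t. t \<in> path_class C R B q D) = (B, q', D)" "path_eq C R B D q q'"
    using some_path_class[OF assms(2)] .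
  have "path_eq C R A D (p @ q) (p' @ q')" by (rule pe_append[OF p'(2) q'(2)])
  then have "path_class C R A (p @ q) D = path_class C R A (p' @ q') D" by (rule path_class_eqI)
  then show ?thesis using p'(1) q'(1) by (simp add: localisation_def)
qed

lemma localisation_simps:
  "Obj (localisation C R) = Obj C"
  "Ide (localisation C R) A = path_class C R A [] A"
  by (simp_all add: localisation_def)

lemma category_localisation: "category (localisation C R)"
proof
  fix c assume "c \<in> Arr (localisation C R)"
  then obtain A p B where p: "path C R A p B" "c = path_class C R A p B"
    by (auto simp: localisation_def)
  then show "Dom (localisation C R) c \<in> Obj (localisation C R)"
    "Cod (localisation C R) c \<in> Obj (localisation C R)"
    using localisation_Dom_Cod[OF p(1)] path_Obj[OF p(1)] by (auto simp: localisation_simps)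
next
  fix A assume "A \<in> Obj (localisation C R)"
  then show "Ide (localisation C R) A \<in> Hom (localisation C R) A A"
    by (auto simp: localisation_simps localisation_Hom intro: path_Nil)
next
  fix f g A B D
  assume "f \<in> Hom (localisation C R) A B" "g \<in> Hom (localisation C R) B D"
  then show "g \<cdot>\<^bsub>localisation C R\<^esub> f \<in> Hom (localisation C R) A D"
    by (auto simp: localisation_Hom localisation_Cmp intro: path_append)
next
  fix f A B assume "f \<in> Hom (localisation C R) A B"
  then obtain p where p: "path C R A p B" "f = path_class C R A p B"
    by (auto simp: localisation_Hom)
  have "path C R A [] A" "path C R B [] B" using path_Obj[OF p(1)] by (auto intro: path_Nil)
  then show "f \<cdot>\<^bsub>localisation C R\<^esub> Ide (localisation C R) A = f"
    "Ide (localisation C R) B \<cdot>\<^bsub>localisation C R\<^esub> f = f"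
    using p by (simp_all add: localisation_simps localisation_Cmp)
next
  fix f g h A B D E
  assume "f \<in> Hom (localisation C R) A B" "g \<in> Hom (localisation C R) B D"
    "h \<in> Hom (localisation C R) D E"
  then show "(h \<cdot>\<^bsub>localisation C R\<^esub> g) \<cdot>\<^bsub>localisation C R\<^esub> f
      = h \<cdot>\<^bsub>localisation C R\<^esub> (g \<cdot>\<^bsub>localisation C R\<^esub> f)"
    by (auto simp: localisation_Hom localisation_Cmp path_append)
qed

end

text \<open>The arrows of \<open>R\<close> look invertible from a colocal object.\<close>

definition colocal :: "('o, 'm, 'z) cat_scheme \<Rightarrow> 'm set \<Rightarrow> 'o \<Rightarrow> bool" where
  "colocal C R A \<longleftrightarrow> A \<in> Obj C \<and>
    (\<forall>X Y. \<forall>r \<in> R \<inter> Hom C X Y. bij_betw (\<lambda>h. r \<cdot>\<^bsub>C\<^esub> h) (Hom C A X) (Hom C A Y))"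

text \<open>A path from \<open>X\<close> to \<open>Y\<close> acts on arrows from a colocal \<open>A\<close> to \<open>X\<close>: a forward edge composes, and a
  backward edge lifts along the arrow of \<open>R\<close>, which colocality makes possible in exactly one way.\<close>

fun transport :: "('o, 'm, 'z) cat_scheme \<Rightarrow> 'o \<Rightarrow> 'm edge list \<Rightarrow> 'm \<Rightarrow> 'm" where
  "transport C A [] a = a"
| "transport C A (Fwd f # p) a = transport C A p (f \<cdot>\<^bsub>C\<^esub> a)"
| "transport C A (Bwd r # p) a =
     transport C A p (inv_into (Hom C A (Dom C r)) (\<lambda>h. r \<cdot>\<^bsub>C\<^esub> h) a)"

context category
begin

lemma colocal_inverse:
  assumes "colocal C R A" "r \<in> R" "r \<in> Hom C X Y"
  shows "a \<in> Hom C A Y \<Longrightarrow> inv_into (Hom C A (Dom C r)) (\<lambda>h. r \<cdot> h) a \<in> Hom C A X"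
    and "a \<in> Hom C A Y \<Longrightarrow> r \<cdot> inv_into (Hom C A (Dom C r)) (\<lambda>h. r \<cdot> h) a = a"
    and "h \<in> Hom C A X \<Longrightarrow> inv_into (Hom C A (Dom C r)) (\<lambda>h. r \<cdot> h) (r \<cdot> h) = h"
proof -
  have b: "bij_betw (\<lambda>h. r \<cdot> h) (Hom C A X) (Hom C A Y)"
    using assms by (auto simp: colocal_def)
  show "a \<in> Hom C A Y \<Longrightarrow> inv_into (Hom C A (Dom C r)) (\<lambda>h. r \<cdot> h) a \<in> Hom C A X"
    using b inv_into_into[of a "\<lambda>h. r \<cdot> h" "Hom C A X"]
    by (simp add: bij_betw_def Hom_Dom[OF assms(3)])
  show "a \<in> Hom C A Y \<Longrightarrow> r \<cdot> inv_into (Hom C A (Dom C r)) (\<lambda>h. r \<cdot> h) a = a"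
    using b f_inv_into_f[of a "\<lambda>h. r \<cdot> h" "Hom C A X"]
    by (simp add: bij_betw_def Hom_Dom[OF assms(3)])
  show "h \<in> Hom C A X \<Longrightarrow> inv_into (Hom C A (Dom C r)) (\<lambda>h. r \<cdot> h) (r \<cdot> h) = h"
    using b inv_into_f_f[of "\<lambda>h. r \<cdot> h" "Hom C A X"]
    by (simp add: bij_betw_def Hom_Dom[OF assms(3)])
qed

lemma transport_append: "transport C A (p @ q) a = transport C A q (transport C A p a)"
proof (induction p arbitrary: a)
  case (Cons x p)
  then show ?case by (cases x) auto
qed simp

lemma transport_Hom:
  assumes "path C R X p Y" "colocal C R A" "a \<in> Hom C A X"
  shows "transport C A p a \<in> Hom C A Y"
  using assms
proof (induction arbitrary: a rule: path.induct)
  case (path_Bwd r X Y p D)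
  then show ?case using colocal_inverse(1) by simp
qed (auto intro: Cmp_Hom)

text \<open>The action respects each defining relation of the localisation, so it separates arrows of the
  localisation that start at a colocal object; this yields faithfulness below.\<close>

lemma transport_path_eq:
  assumes "path_eq C R X Y p q" "colocal C R A" "a \<in> Hom C A X"
  shows "transport C A p a = transport C A q a"
  using assms
proof (induction arbitrary: a rule: path_eq.induct)
  case (pe_append X Y p p' D q q')
  then have "transport C A p a \<in> Hom C A Y" by (meson path_eq_path transport_Hom)
  then show ?case using pe_append by (simp add: transport_append)
next
  case (pe_Cmp f X Y g D)
  then show ?case by (simp add: Cmp_assoc)
next
  case (pe_Fwd_Bwd r X Y)
  then show ?case using colocal_inverse(3) by simp
next
  case (pe_Bwd_Fwd r X Y)
  then show ?case using colocal_inverse(2) by simp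
qed (auto simp: Ide_Cmp)

text \<open>Backward edges can be removed one by one from a path starting with an arrow out of a colocal
  object: \<open>a = r \<cdot> h\<close> turns \<open>a\<close> followed by the inverse of \<open>r\<close> into \<open>h\<close>. This yields fullness
  below.\<close>

lemma path_eq_transport:
  assumes "path C R X p Y" "colocal C R A" "a \<in> Hom C A X"
  shows "path_eq C R A Y (Fwd a # p) [Fwd (transport C A p a)]"
  using assms
proof (induction arbitrary: a rule: path.induct)
  case (path_Nil X)
  then show ?case by (simp add: pe_refl path_single)
next
  case (path_Fwd f X Y p D)
  have fa: "f \<cdot> a \<in> Hom C A Y" using path_Fwd by (meson Cmp_Hom)
  have "path_eq C R A D ([Fwd a, Fwd f] @ p) ([Fwd (f \<cdot> a)] @ p)"
    using path_Fwd by (intro pe_append[OF pe_Cmp] pe_refl)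
  then show ?case using path_Fwd.IH[OF path_Fwd.prems(1) fa] by (auto intro: pe_trans)
next
  case (path_Bwd r X Y p D)
  define h where "h = inv_into (Hom C A (Dom C r)) (\<lambda>h. r \<cdot> h) a"
  have h: "h \<in> Hom C A X" "r \<cdot> h = a"
    using colocal_inverse[of R A r X Y] path_Bwd by (auto simp: h_def)
  have "path_eq C R A Y [Fwd h, Fwd r] [Fwd a]"
    using pe_Cmp[OF h(1), of r Y R] h(2) path_Bwd.hyps by simp
  moreover have rp: "path C R Y (Bwd r # p) D" using path_Bwd.hyps by (intro path.path_Bwd)
  ultimately have "path_eq C R A D ([Fwd a] @ Bwd r # p) ([Fwd h, Fwd r] @ Bwd r # p)"
    by (intro pe_append pe_sym[of _ _ _ _ "[Fwd h, Fwd r]"] pe_refl)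
  moreover have "path_eq C R A D ([Fwd h] @ ([Fwd r, Bwd r] @ p)) ([Fwd h] @ ([] @ p))"
    using path_Bwd.hyps h(1) by (intro pe_append[OF pe_refl] pe_append[OF pe_Fwd_Bwd] pe_refl path_single)
  ultimately have "path_eq C R A D (Fwd a # Bwd r # p) (Fwd h # p)"
    using pe_trans by fastforce
  then show ?case
    using path_Bwd.IH[OF path_Bwd.prems(1) h(1)] by (auto simp: h_def intro: pe_trans)
qed

text \<open>The functor from \<open>E\<close> to the localisation sends an arrow to the one-edge path. Evaluating the
  action of a path at the identity inverts it on morphisms, and the approximations in \<open>R\<close> become
  isomorphisms, which makes it essentially surjective.\<close>

theorem localisation_equivalent_colocal_subcategory:
  assumes E: "full_subcategory_of E C"
    and col: "\<And>A. A \<in> Obj E \<Longrightarrow> colocal C R A"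
    and approx: "\<And>X. X \<in> Obj C \<Longrightarrow> \<exists>A \<in> Obj E. \<exists>r \<in> R. r \<in> Hom C A X"
  shows "equivalent_cats (localisation C R) E"
proof -
  let ?L = "localisation C R"
  interpret E: category E using full_subcategory_of_category[OF E] category_axioms .
  have sub: "Obj E \<subseteq> Obj C"
    and H: "\<And>A B. \<lbrakk>A \<in> Obj E; B \<in> Obj E\<rbrakk> \<Longrightarrow> Hom E A B = Hom C A B"
    and I: "\<And>A. A \<in> Obj E \<Longrightarrow> Ide E A = Ide C A"
    and Cm: "\<And>A B X f g. \<lbrakk>A \<in> Obj E; B \<in> Obj E; X \<in> Obj E; f \<in> Hom C A B; g \<in> Hom C B X\<rbrakk>
       \<Longrightarrow> g \<cdot>\<^bsub>E\<^esub> f = g \<cdot> f"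
    using E unfolding full_subcategory_of_def by blast+
  define F where "F f = path_class C R (Dom E f) [Fwd f] (Cod E f)" for f
  have F: "F f = path_class C R A [Fwd f] B" if "f \<in> Hom E A B" for f A B
    using Hom_Dom[OF that] Hom_Cod[OF that] by (simp add: F_def)
  have HE: "A \<in> Obj E \<and> B \<in> Obj E \<and> f \<in> Hom C A B" if "f \<in> Hom E A B" for f A B
    using E.Hom_Obj[OF that] H that by auto
  have func: "is_functor E ?L id F"
    unfolding is_functor_def
  proof (intro conjI ballI impI)
    fix A assume A: "A \<in> Obj E"
    then have A': "A \<in> Obj C" using sub by auto
    show "id A \<in> Obj ?L" using A' by (simp add: localisation_simps)
    have "path_class C R A [Fwd (Ide C A)] A = path_class C R A [] A"
      by (rule path_class_eqI[OF pe_Ide[OF A']])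
    then show "F (Ide E A) = Ide ?L (id A)"
      using F[OF E.Ide_Hom[OF A]] I[OF A] by (simp add: localisation_simps)
  next
    fix A B f assume "f \<in> Hom E A B"
    then show "F f \<in> Hom ?L (id A) (id B)"
      using F HE path_single by (auto simp: localisation_Hom)
  next
    fix f g assume "f \<in> Arr E" "g \<in> Arr E" "Dom E g = Cod E f"
    then obtain X Y Z where f: "f \<in> Hom E X Y" and g: "g \<in> Hom E Y Z"
      by (auto simp: Hom_def)
    have "path_class C R X [Fwd f, Fwd g] Z = path_class C R X [Fwd (g \<cdot> f)] Z"
      using HE[OF f] HE[OF g] by (intro path_class_eqI pe_Cmp) auto
    moreover have "F g \<cdot>\<^bsub>?L\<^esub> F f = path_class C R X [Fwd f, Fwd g] Z"
      using localisation_Cmp[OF path_single path_single] HE[OF f] HE[OF g] F[OF f] F[OF g]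
      by simp
    ultimately show "F (g \<cdot>\<^bsub>E\<^esub> f) = F g \<cdot>\<^bsub>?L\<^esub> F f"
      using F[OF E.Cmp_Hom[OF f g]] Cm[of X Y Z f g] HE[OF f] HE[OF g] by simp
  qed
  have "equivalent_cats E ?L"
  proof (rule fully_faithful_essentially_surjective_equivalence[OF E.category_axioms
        category_localisation func])
    fix A B assume A: "A \<in> Obj E" and B: "B \<in> Obj E"
    have IA: "Ide C A \<in> Hom C A A" using A sub Ide_Hom by auto
    show "bij_betw F (Hom E A B) (Hom ?L (id A) (id B))"
      unfolding bij_betw_def
    proof (intro conjI inj_onI equalityI subsetI)
      fix f g assume f: "f \<in> Hom E A B" and g: "g \<in> Hom E A B" and "F f = F g"
      then have "path_class C R A [Fwd f] B = path_class C R A [Fwd g] B" by (simp add: F)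
      then have "path_eq C R A B [Fwd f] [Fwd g]"
        using path_class_eq_iff path_single HE[OF f] HE[OF g] by blast
      from transport_path_eq[OF this col[OF A] IA] show "f = g"
        using HE[OF f] HE[OF g] Cmp_Ide by auto
    next
      fix c assume "c \<in> F ` Hom E A B"
      then show "c \<in> Hom ?L (id A) (id B)"
        using F HE path_single by (auto simp: localisation_Hom)
    next
      fix c assume "c \<in> Hom ?L (id A) (id B)"
      then obtain p where p: "path C R A p B" "c = path_class C R A p B"
        by (auto simp: localisation_Hom)
      define k where "k = transport C A p (Ide C A)"
      have k: "k \<in> Hom E A B" using transport_Hom[OF p(1) col[OF A] IA] H A B by (simp add: k_def)
      have "path_eq C R A B ([Fwd (Ide C A)] @ p) ([] @ p)"
        using A sub p(1) by (intro pe_append[OF pe_Ide] pe_refl) auto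
      then have "path_eq C R A B p [Fwd k]"
        using path_eq_transport[OF p(1) col[OF A] IA]
        by (auto simp: k_def intro: pe_trans pe_sym)
      then have "c = F k" using path_class_eqI F[OF k] p(2) by simp
      then show "c \<in> F ` Hom E A B" using k by auto
    qed
  next
    fix X assume "X \<in> Obj ?L"
    then have "X \<in> Obj C" by (simp add: localisation_simps)
    then obtain A r where A: "A \<in> Obj E" and r: "r \<in> R" "r \<in> Hom C A X" using approx by blast
    have AX: "A \<in> Obj C" "X \<in> Obj C" using Hom_Obj[OF r(2)] by auto
    have fwd: "path C R A [Fwd r] X" by (rule path_single[OF r(2)])
    have bwd: "path C R X [Bwd r] A" using r AX by (meson path.intros)
    have "path_class C R X [Bwd r] A \<cdot>\<^bsub>?L\<^esub> path_class C R A [Fwd r] X = Ide ?L A"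
      using localisation_Cmp[OF fwd bwd] path_class_eqI[OF pe_Fwd_Bwd[OF r]]
      by (simp add: localisation_simps)
    moreover have "path_class C R A [Fwd r] X \<cdot>\<^bsub>?L\<^esub> path_class C R X [Bwd r] A = Ide ?L X"
      using localisation_Cmp[OF bwd fwd] path_class_eqI[OF pe_Bwd_Fwd[OF r]]
      by (simp add: localisation_simps)
    moreover have "path_class C R A [Fwd r] X \<in> Hom ?L A X" "path_class C R X [Bwd r] A \<in> Hom ?L X A"
      using fwd bwd by (auto simp: localisation_Hom)
    ultimately have "is_iso ?L (path_class C R A [Fwd r] X)" by (meson is_isoI)
    then show "\<exists>A \<in> Obj E. \<exists>e \<in> Hom ?L (id A) X. is_iso ?L e"
      using A \<open>path_class C R A [Fwd r] X \<in> Hom ?L A X\<close> by auto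
  qed
  then show ?thesis by (rule equivalent_cats_sym)
qed

end

section \<open>Triangulated categories\<close>

context preadditive_category
begin

lemma hom_group_simps:
  "carrier (hom_group C A B) = Hom C A B"
  "x \<otimes>\<^bsub>hom_group C A B\<^esub> y = Plus C x y"
  "\<one>\<^bsub>hom_group C A B\<^esub> = Null C A B"
  by (simp_all add: hom_group_def)

lemma hom_group_of: "f \<in> Hom C A B \<Longrightarrow> comm_group (hom_group C A B)"
  using Hom_Obj hom_comm_group by blast

lemma Null_Hom: "\<lbrakk>A \<in> Obj C; B \<in> Obj C\<rbrakk> \<Longrightarrow> Null C A B \<in> Hom C A B"
  using monoid.one_closed[of "hom_group C A B"] hom_comm_group[of A B]
  by (simp add: comm_group_def group_def hom_group_simps)

lemma Plus_Hom: "\<lbrakk>f \<in> Hom C A B; g \<in> Hom C A B\<rbrakk> \<Longrightarrow> Plus C f g \<in> Hom C A B"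
  using monoid.m_closed[of "hom_group C A B" f g] hom_group_of[of f A B]
  by (simp add: comm_group_def group_def hom_group_simps)

lemma neg_eq: "f \<in> Hom C A B \<Longrightarrow> neg C f = inv\<^bsub>hom_group C A B\<^esub> f"
  by (simp add: neg_def Hom_Dom Hom_Cod)

lemma neg_Hom: "f \<in> Hom C A B \<Longrightarrow> neg C f \<in> Hom C A B"
  using group.inv_closed[of "hom_group C A B" f] hom_group_of[of f A B]
  by (simp add: comm_group_def neg_eq hom_group_simps)

lemma Plus_neg: "f \<in> Hom C A B \<Longrightarrow> Plus C f (neg C f) = Null C A B"
  using group.r_inv[of "hom_group C A B" f] hom_group_of[of f A B]
  by (simp add: comm_group_def neg_eq hom_group_simps)

lemma Plus_commute: "\<lbrakk>f \<in> Hom C A B; g \<in> Hom C A B\<rbrakk> \<Longrightarrow> Plus C f g = Plus C g f"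
  using comm_monoid.m_comm[of "hom_group C A B" f g] hom_group_of[of f A B]
  by (simp add: comm_group_def hom_group_simps)

lemma Plus_assoc:
  "\<lbrakk>f \<in> Hom C A B; g \<in> Hom C A B; h \<in> Hom C A B\<rbrakk>
    \<Longrightarrow> Plus C (Plus C f g) h = Plus C f (Plus C g h)"
  using monoid.m_assoc[of "hom_group C A B" f g h] hom_group_of[of f A B]
  by (simp add: comm_group_def group_def hom_group_simps)

lemma Plus_Null: "f \<in> Hom C A B \<Longrightarrow> Plus C f (Null C A B) = f"
  using monoid.r_one[of "hom_group C A B" f] hom_group_of[of f A B]
  by (simp add: comm_group_def group_def hom_group_simps)

lemma Null_unique:
  assumes "f \<in> Hom C A B" "Plus C f f = f" shows "f = Null C A B"
  using group.l_cancel_one'[of "hom_group C A B" f f] hom_group_of[OF assms(1)] assms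
  by (simp add: comm_group_def hom_group_simps)

lemma neg_unique:
  assumes "f \<in> Hom C A B" "g \<in> Hom C A B" "Plus C f g = Null C A B"
  shows "g = neg C f"
  using group.inv_equality[of "hom_group C A B" g f] hom_group_of[OF assms(1)] assms
    Plus_commute[OF assms(1,2)]
  by (simp add: comm_group_def hom_group_simps neg_eq[OF assms(1)])

lemma neg_neg: "f \<in> Hom C A B \<Longrightarrow> neg C (neg C f) = f"
  using neg_unique[OF neg_Hom, of f A B f] Plus_commute[OF neg_Hom, of f A B f] Plus_neg[of f A B]
  by simp

lemma Cmp_Null:
  assumes "g \<in> Hom C B D" "A \<in> Obj C" shows "g \<cdot> Null C A B = Null C A D"
proof -
  have n: "Null C A B \<in> Hom C A B" using assms Hom_Obj Null_Hom by blast
  show ?thesis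
    using Null_unique[OF Cmp_Hom[OF n assms(1)]] Cmp_Plus[OF n n assms(1)] Plus_Null[OF n] by simp
qed

lemma Null_Cmp:
  assumes "f \<in> Hom C A B" "D \<in> Obj C" shows "Null C B D \<cdot> f = Null C A D"
proof -
  have n: "Null C B D \<in> Hom C B D" using assms Hom_Obj Null_Hom by blast
  show ?thesis
    using Null_unique[OF Cmp_Hom[OF assms(1) n]] Plus_Cmp[OF assms(1) n n] Plus_Null[OF n] by simp
qed

lemma Cmp_neg:
  assumes "f \<in> Hom C A B" "g \<in> Hom C B D" shows "g \<cdot> neg C f = neg C (g \<cdot> f)"
  using neg_unique[OF Cmp_Hom[OF assms] Cmp_Hom[OF neg_Hom[OF assms(1)] assms(2)]]
    Cmp_Plus[OF assms(1) neg_Hom[OF assms(1)] assms(2)] Plus_neg[OF assms(1)]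
    Cmp_Null[OF assms(2)] Hom_Obj[OF assms(1)] by simp

lemma neg_Cmp:
  assumes "f \<in> Hom C A B" "g \<in> Hom C B D" shows "neg C g \<cdot> f = neg C (g \<cdot> f)"
  using neg_unique[OF Cmp_Hom[OF assms] Cmp_Hom[OF assms(1) neg_Hom[OF assms(2)]]]
    Plus_Cmp[OF assms(1) assms(2) neg_Hom[OF assms(2)]] Plus_neg[OF assms(2)]
    Null_Cmp[OF assms(1)] Hom_Obj[OF assms(2)] by simp

abbreviation diff :: "'m \<Rightarrow> 'm \<Rightarrow> 'm" where
  "diff f g \<equiv> Plus C f (neg C g)"

lemma diff_Hom: "\<lbrakk>f \<in> Hom C A B; g \<in> Hom C A B\<rbrakk> \<Longrightarrow> diff f g \<in> Hom C A B"
  by (intro Plus_Hom neg_Hom)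

lemma Plus_diff:
  assumes "f \<in> Hom C A B" "g \<in> Hom C A B"
  shows "Plus C g (diff f g) = f"
proof -
  note n = neg_Hom[OF assms(2)]
  have "Plus C g (diff f g) = Plus C g (Plus C (neg C g) f)"
    using Plus_commute[OF assms(1) n] by simp
  also have "\<dots> = Plus C f (Null C A B)"
    using Plus_assoc[OF assms(2) n assms(1)] Plus_neg[OF assms(2)]
      Plus_commute[OF Plus_Hom[OF assms(2) n] assms(1)] by simp
  finally show ?thesis using Plus_Null[OF assms(1)] by simp
qed

lemma diff_eq_Null_iff:
  assumes "f \<in> Hom C A B" "g \<in> Hom C A B"
  shows "diff f g = Null C A B \<longleftrightarrow> f = g"
  using Plus_diff[OF assms] Plus_Null[OF assms(2)] Plus_neg[OF assms(2)] by auto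

lemma Cmp_diff:
  "\<lbrakk>f \<in> Hom C A B; f' \<in> Hom C A B; g \<in> Hom C B D\<rbrakk> \<Longrightarrow> g \<cdot> diff f f' = diff (g \<cdot> f) (g \<cdot> f')"
  using Cmp_Plus[of f A B "neg C f'" g D] neg_Hom Cmp_neg by simp

lemma diff_Cmp:
  "\<lbrakk>f \<in> Hom C A B; g \<in> Hom C B D; g' \<in> Hom C B D\<rbrakk> \<Longrightarrow> diff g g' \<cdot> f = diff (g \<cdot> f) (g' \<cdot> f)"
  using Plus_Cmp[of f A B g D "neg C g'"] neg_Hom neg_Cmp by simp

lemma Hom_zero_object:
  assumes "zero_object C Z"
  shows "f \<in> Hom C A Z \<Longrightarrow> f = Null C A Z" and "g \<in> Hom C Z B \<Longrightarrow> g = Null C Z B"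
proof -
  have Z: "Z \<in> Obj C" "Ide C Z = Null C Z Z" using assms by (auto simp: zero_object_def)
  show "f = Null C A Z" if "f \<in> Hom C A Z"
    using Ide_Cmp[OF that] Null_Cmp[OF that Z(1)] Z(2) by simp
  show "g = Null C Z B" if "g \<in> Hom C Z B"
    using Cmp_Ide[OF that] Cmp_Null[OF that Z(1)] Z(2) by simp
qed

lemma direct_sum_0: "direct_sum C 0 A Z \<longleftrightarrow> zero_object C Z"
proof -
  have "finprod (hom_group C Z Z) f {} = Null C Z Z" if "Z \<in> Obj C" for f :: "nat \<Rightarrow> 'm"
    using comm_monoid.finprod_empty[of "hom_group C Z Z" f] hom_comm_group[OF that that]
    by (simp add: comm_group_def hom_group_simps)
  then show ?thesis by (auto simp: direct_sum_def zero_object_def)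
qed

lemma direct_sum_2:
  assumes "i \<in> Hom C A X" "p \<in> Hom C X A" "j \<in> Hom C B X" "q \<in> Hom C X B"
    and "p \<cdot> i = Ide C A" "q \<cdot> j = Ide C B" "q \<cdot> i = Null C A B" "p \<cdot> j = Null C B A"
    and sum: "Plus C (i \<cdot> p) (j \<cdot> q) = Ide C X"
  shows "direct_sum C 2 (\<lambda>k. if k = 0 then A else B) X"
proof -
  have O: "A \<in> Obj C" "X \<in> Obj C" "B \<in> Obj C" using Hom_Obj assms by blast+
  have G: "comm_group (hom_group C X X)" by (rule hom_comm_group[OF O(2) O(2)])
  then interpret G: comm_group "hom_group C X X" .
  let ?i = "\<lambda>k::nat. if k = 0 then i else j" and ?p = "\<lambda>k::nat. if k = 0 then p else q"
  have H: "i \<cdot> p \<in> Hom C X X" "j \<cdot> q \<in> Hom C X X" using Cmp_Hom assms by blast+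
  have "{..<2::nat} = {0, 1}" by auto
  then have "finprod (hom_group C X X) (\<lambda>k. ?i k \<cdot> ?p k) {..<2} = Plus C (i \<cdot> p) (j \<cdot> q)"
    using H by (simp add: G.finprod_insert hom_group_simps Pi_def Plus_Null)
  then show ?thesis
    unfolding direct_sum_def using assms O by (intro conjI exI[of _ ?i] exI[of _ ?p]) auto
qed

end

context triangulated_category
begin

lemma SuspO_Obj: "X \<in> Obj C \<Longrightarrow> SuspO C X \<in> Obj C"
  using SuspO_bij by (auto simp: bij_betw_def)

lemma SuspO_surj: "Y \<in> Obj C \<Longrightarrow> \<exists>X \<in> Obj C. SuspO C X = Y"
  using SuspO_bij by (metis bij_betw_iff_bijections)

lemma SuspA_Hom: "f \<in> Hom C A B \<Longrightarrow> SuspA C f \<in> Hom C (SuspO C A) (SuspO C B)"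
  by (rule is_functor_Hom[OF Susp_functor category_axioms])

lemma SuspA_Cmp: "\<lbrakk>f \<in> Hom C A B; g \<in> Hom C B D\<rbrakk> \<Longrightarrow> SuspA C (g \<cdot> f) = SuspA C g \<cdot> SuspA C f"
  by (rule is_functor_Cmp[OF Susp_functor])

lemma SuspA_Ide: "A \<in> Obj C \<Longrightarrow> SuspA C (Ide C A) = Ide C (SuspO C A)"
  using Susp_functor by (auto simp: is_functor_def)

lemma SuspA_inj: "\<lbrakk>f \<in> Hom C A B; g \<in> Hom C A B; SuspA C f = SuspA C g\<rbrakk> \<Longrightarrow> f = g"
  using SuspA_bij by (auto simp: bij_betw_def inj_on_def Hom_def)

lemma SuspA_full:
  assumes "A \<in> Obj C" "B \<in> Obj C" "g \<in> Hom C (SuspO C A) (SuspO C B)"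
  obtains f where "f \<in> Hom C A B" "SuspA C f = g"
proof -
  obtain f where f: "f \<in> Arr C" "SuspA C f = g"
    using SuspA_bij Hom_Arr[OF assms(3)] by (metis bij_betw_iff_bijections)
  then have "SuspO C (Dom C f) = SuspO C A" "SuspO C (Cod C f) = SuspO C B"
    using SuspA_Hom[OF Arr_Hom] assms(3) by (metis Hom_Dom, metis Hom_Cod)
  then have "Dom C f = A" "Cod C f = B"
    using SuspO_bij assms(1,2) Dom_closed Cod_closed f(1) by (auto simp: bij_betw_def inj_on_def)
  with f show ?thesis using that[of f] by (simp add: Hom_def)
qed

lemma SuspA_Null:
  assumes "A \<in> Obj C" "B \<in> Obj C"
  shows "SuspA C (Null C A B) = Null C (SuspO C A) (SuspO C B)"
  using Null_unique[OF SuspA_Hom[OF Null_Hom[OF assms]]]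
    SuspA_Plus[OF Null_Hom[OF assms] Null_Hom[OF assms]] Plus_Null[OF Null_Hom[OF assms]] by simp

lemma neg_Null:
  assumes "A \<in> Obj C" "B \<in> Obj C" shows "neg C (Null C A B) = Null C A B"
  using neg_unique[OF Null_Hom[OF assms] Null_Hom[OF assms]] Plus_Null[OF Null_Hom[OF assms]] by simp

lemma ex_zero_object: "\<exists>Z. zero_object C Z"
  using ex_direct_sum[of 0] direct_sum_0 by auto

lemma zero_object_SuspO: "zero_object C Z \<Longrightarrow> zero_object C (SuspO C Z)"
  using SuspA_Ide[of Z] SuspA_Null[of Z Z] SuspO_Obj[of Z] by (simp add: zero_object_def)

text \<open>Distinguished triangles with their objects displayed; the third morphism ends at the
  suspension of the first object.\<close>

definition triangle :: "'o \<Rightarrow> 'o \<Rightarrow> 'o \<Rightarrow> 'm \<Rightarrow> 'm \<Rightarrow> 'm \<Rightarrow> bool" where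
  "triangle X Y Z u v w \<longleftrightarrow> (u, v, w) \<in> Tri C \<and>
    u \<in> Hom C X Y \<and> v \<in> Hom C Y Z \<and> w \<in> Hom C Z (SuspO C X)"

lemma triangle_Hom:
  assumes "triangle X Y Z u v w"
  shows "u \<in> Hom C X Y" "v \<in> Hom C Y Z" "w \<in> Hom C Z (SuspO C X)" "(u, v, w) \<in> Tri C"
    "X \<in> Obj C" "Y \<in> Obj C" "Z \<in> Obj C"
  using assms Hom_Obj unfolding triangle_def by blast+

lemma triangle_of_Tri:
  assumes "(u, v, w) \<in> Tri C" "u \<in> Hom C X Y"
  shows "triangle X Y (Cod C v) u v w"
proof -
  obtain X' Y' Z where h: "u \<in> Hom C X' Y'" "v \<in> Hom C Y' Z" "w \<in> Hom C Z (SuspO C X')"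
    using Tri_Arr[OF assms(1)] by blast
  then have "X' = X" "Y' = Y" "Z = Cod C v" using assms(2) by (simp_all add: Hom_def)
  with h assms show ?thesis by (simp add: triangle_def)
qed

lemma ex_triangle:
  assumes "u \<in> Hom C X Y" obtains Z v w where "triangle X Y Z u v w"
  using TR1_cone[OF Hom_Arr[OF assms]] triangle_of_Tri[OF _ assms] by blast

lemma star_iff:
  "E \<in> star C M N \<longleftrightarrow> (\<exists>A \<in> M. \<exists>B \<in> N. \<exists>u v w. triangle A E B u v w)"
proof
  assume "E \<in> star C M N"
  then obtain u v w where t: "(u, v, w) \<in> Tri C" "Dom C u \<in> M" "Cod C u = E" "Cod C v \<in> N"
    by (auto simp: star_def)
  then have "u \<in> Hom C (Dom C u) E" using Tri_Arr[OF t(1)] by (auto simp: Hom_def)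
  from triangle_of_Tri[OF t(1) this] show "\<exists>A \<in> M. \<exists>B \<in> N. \<exists>u v w. triangle A E B u v w"
    using t by blast
next
  assume "\<exists>A \<in> M. \<exists>B \<in> N. \<exists>u v w. triangle A E B u v w"
  then obtain A B u v w where "A \<in> M" "B \<in> N" and t: "triangle A E B u v w" by blast
  then show "E \<in> star C M N"
    using Hom_Dom[OF triangle_Hom(1)[OF t]] Hom_Cod[OF triangle_Hom(1)[OF t]]
      Hom_Cod[OF triangle_Hom(2)[OF t]] triangle_Hom(4,6)[OF t]
    unfolding star_def by auto
qed

lemma rotate:
  assumes "triangle X Y Z u v w"
  shows "triangle Y Z (SuspO C X) v w (neg C (SuspA C u))"
proof -
  note h = triangle_Hom[OF assms]
  show ?thesis
    using TR2[OF h(1-3)] h neg_Hom[OF SuspA_Hom[OF h(1)]] by (simp add: triangle_def)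
qed

text \<open>The suspension is full, so the sign in the rotation axiom can be absorbed into the choice of
  the first morphism.\<close>

lemma unrotate:
  assumes t: "triangle Y Z (SuspO C X) v w z" and X: "X \<in> Obj C"
  obtains u where "triangle X Y Z u v w"
proof -
  note h = triangle_Hom[OF t]
  obtain u where u: "u \<in> Hom C X Y" "SuspA C u = neg C z"
    using SuspA_full[OF X h(5) neg_Hom[OF h(3)]] .
  then have "z = neg C (SuspA C u)" using neg_neg[OF h(3)] by simp
  then have "triangle X Y Z u v w" using TR2[OF u(1) h(1,2)] h u by (simp add: triangle_def)
  then show ?thesis by (rule that)
qed

text \<open>Three backward rotations; only the objects of the resulting triangle matter.\<close>

lemma desuspend:
  assumes t: "triangle (SuspO C X) (SuspO C Y) (SuspO C Z) u v w"
    and O: "X \<in> Obj C" "Y \<in> Obj C" "Z \<in> Obj C"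
  obtains u' v' w' where "triangle X Y Z u' v' w'"
proof -
  obtain w' where "triangle Z (SuspO C X) (SuspO C Y) w' u v" using unrotate[OF t O(3)] .
  from unrotate[OF this O(2)] obtain v' where "triangle Y Z (SuspO C X) v' w' u" .
  from unrotate[OF this O(1)] show ?thesis using that by blast
qed

lemma triangle_Ide:
  assumes X: "X \<in> Obj C" and Z: "zero_object C Z"
  shows "triangle X X Z (Ide C X) (Null C X Z) (Null C Z (SuspO C X))"
proof -
  have "Z \<in> Obj C" using Z by (simp add: zero_object_def)
  then show ?thesis
    using TR1_Ide[OF X Z] Ide_Hom[OF X] Null_Hom[OF X] Null_Hom[OF _ SuspO_Obj[OF X]]
    by (simp add: triangle_def)
qed

lemma triangle_zero:
  assumes X: "X \<in> Obj C" and Z: "zero_object C Z"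
  shows "triangle Z X X (Null C Z X) (Ide C X) (Null C X (SuspO C Z))"
proof -
  have Z': "Z \<in> Obj C" using Z by (simp add: zero_object_def)
  obtain u where u: "triangle Z X X u (Ide C X) (Null C X (SuspO C Z))"
    using unrotate[OF triangle_Ide[OF X zero_object_SuspO[OF Z]] Z'] .
  then show ?thesis using Hom_zero_object(2)[OF Z triangle_Hom(1)[OF u]] by simp
qed

lemma triangle_map:
  assumes t: "triangle X Y Z u v w" and t': "triangle X' Y' Z' u' v' w'"
    and a: "a \<in> Hom C X X'" and b: "b \<in> Hom C Y Y'" and ba: "b \<cdot> u = u' \<cdot> a"
  obtains c where "c \<in> Hom C Z Z'" "c \<cdot> v = v' \<cdot> b" "SuspA C a \<cdot> w = w' \<cdot> c"
proof -
  note h = triangle_Hom[OF t] and h' = triangle_Hom[OF t']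
  have "\<exists>c \<in> Hom C Z Z'. c \<cdot> v = v' \<cdot> b \<and> SuspA C a \<cdot> w = w' \<cdot> c"
    using TR3[OF h(4) h'(4), of a b] a b ba h(1,2) h'(1,2) by (simp add: Hom_Dom Hom_Cod)
  then show ?thesis using that by blast
qed

lemma triangle_Cmp:
  assumes t: "triangle X Y Z u v w" shows "v \<cdot> u = Null C X Z"
proof -
  note h = triangle_Hom[OF t]
  obtain N where N: "zero_object C N" using ex_zero_object by blast
  have "u \<cdot> Ide C X = u \<cdot> Ide C X" ..
  then obtain c where "c \<in> Hom C N Z" "c \<cdot> Null C X N = v \<cdot> u"
    using triangle_map[OF triangle_Ide[OF h(5) N] t Ide_Hom[OF h(5)] h(1)] by blast
  then show ?thesis using Cmp_Null h(5) by metis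
qed

text \<open>Extend \<open>(0, g)\<close> to a map into the triangle \<open>0 \<rightarrow> A \<rightarrow> A \<rightarrow> 0\<close>.\<close>

lemma weak_cokernel:
  assumes t: "triangle X Y Z u v w" and g: "g \<in> Hom C Y A" and "g \<cdot> u = Null C X A"
  obtains k where "k \<in> Hom C Z A" "g = k \<cdot> v"
proof -
  note h = triangle_Hom[OF t]
  obtain N where N: "zero_object C N" using ex_zero_object by blast
  have A: "A \<in> Obj C" "N \<in> Obj C" using Hom_Obj[OF g] N by (auto simp: zero_object_def)
  have n: "Null C X N \<in> Hom C X N" using Null_Hom h(5) A by blast
  have "g \<cdot> u = Null C N A \<cdot> Null C X N" using assms(3) Null_Cmp[OF n A(1)] by simp
  then obtain c where "c \<in> Hom C Z A" "c \<cdot> v = Ide C A \<cdot> g"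
    using triangle_map[OF t triangle_zero[OF A(1) N] n g] by blast
  then show ?thesis using that Ide_Cmp[OF g] by metis
qed

text \<open>Extend \<open>(s, 0)\<close> to a map from the triangle \<open>P \<rightarrow> 0 \<rightarrow> \<Sigma>P \<rightarrow> \<Sigma>P\<close> into the rotated triangle and
  desuspend its third component; the two signs introduced by rotation cancel.\<close>

lemma weak_kernel:
  assumes t: "triangle X Y Z u v w" and s: "s \<in> Hom C P Y" and "v \<cdot> s = Null C P Z"
  obtains k where "k \<in> Hom C P X" "s = u \<cdot> k"
proof -
  note h = triangle_Hom[OF t]
  obtain N where N: "zero_object C N" using ex_zero_object by blast
  have P: "P \<in> Obj C" "N \<in> Obj C" using Hom_Obj[OF s] N by (auto simp: zero_object_def)
  have n: "Null C N Z \<in> Hom C N Z" using Null_Hom h(7) P by blast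
  have nP: "Null C P N \<in> Hom C P N" using Null_Hom P by blast
  have "Null C N Z \<cdot> Null C P N = v \<cdot> s" using assms(3) Null_Cmp[OF nP h(7)] by simp
  then obtain c where c: "c \<in> Hom C (SuspO C P) (SuspO C X)"
    "SuspA C s \<cdot> neg C (SuspA C (Ide C P)) = neg C (SuspA C u) \<cdot> c"
    using triangle_map[OF rotate[OF triangle_Ide[OF P(1) N]] rotate[OF t] s n] by metis
  obtain k where k: "k \<in> Hom C P X" "SuspA C k = c" using SuspA_full[OF P(1) h(5) c(1)] .
  note Ss = SuspA_Hom[OF s] and Su = SuspA_Hom[OF h(1)]
  have "SuspA C s \<cdot> neg C (SuspA C (Ide C P)) = neg C (SuspA C s)"
    using Cmp_neg[OF Ide_Hom[OF SuspO_Obj[OF P(1)]] Ss] SuspA_Ide[OF P(1)] Cmp_Ide[OF Ss] by simp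
  moreover have "neg C (SuspA C u) \<cdot> c = neg C (SuspA C (u \<cdot> k))"
    using neg_Cmp[OF c(1) Su] SuspA_Cmp[OF k(1) h(1)] k(2) by simp
  ultimately have "neg C (SuspA C s) = neg C (SuspA C (u \<cdot> k))" using c(2) by simp
  then have "SuspA C s = SuspA C (u \<cdot> k)"
    using neg_neg[OF Ss] neg_neg[OF SuspA_Hom[OF Cmp_Hom[OF k(1) h(1)]]] by metis
  then have "s = u \<cdot> k" by (rule SuspA_inj[OF s Cmp_Hom[OF k(1) h(1)]])
  with k show ?thesis using that by blast
qed

text \<open>The part of the octahedral axiom that is needed: the cone of a composite is an extension of
  the two cones.\<close>

lemma cone_of_Cmp:
  assumes t: "triangle X Y A u i i'" "triangle Y Z B v j j'" "triangle X Z D (v \<cdot> u) k k'"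
  obtains f g h where "triangle A D B f g h"
proof -
  note h1 = triangle_Hom[OF t(1)] and h2 = triangle_Hom[OF t(2)] and h3 = triangle_Hom[OF t(3)]
  obtain f g where "f \<in> Hom C A D" "g \<in> Hom C D B" "(f, g, SuspA C i \<cdot> j') \<in> Tri C"
    using TR4[OF h1(1) h2(1) h1(4) h2(4) h3(4)] Hom_Cod[OF h1(2)] Hom_Cod[OF h2(2)] Hom_Cod[OF h3(2)]
    by auto
  moreover have "SuspA C i \<cdot> j' \<in> Hom C B (SuspO C A)"
    using Cmp_Hom[OF h2(3) SuspA_Hom[OF h1(2)]] .
  ultimately show ?thesis using that by (simp add: triangle_def)
qed

text \<open>Closure under direct summands is expressed by biproduct decompositions, so a retract must
  first be given a complement. The cone \<open>v : U \<rightarrow> Y\<close> of the section \<open>t\<close> is one: its connecting morphism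
  vanishes because \<open>\<Sigma>t\<close> is a split monomorphism, so \<open>v\<close> has a section, and correcting that section by
  \<open>t \<cdot> u\<close> makes it orthogonal to \<open>u\<close>.\<close>

lemma summand_closed_retract:
  assumes M: "summand_closed C M" "U \<in> M"
    and t: "t \<in> Hom C X U" and u: "u \<in> Hom C U X" and ut: "u \<cdot> t = Ide C X"
  shows "X \<in> M"
proof -
  obtain Y v w where tri: "triangle X U Y t v w" using ex_triangle[OF t] .
  note h = triangle_Hom[OF tri]
  note r = rotate[OF tri] and v = h(2)
  have vt: "v \<cdot> t = Null C X Y" by (rule triangle_Cmp[OF tri])
  have "w = Null C Y (SuspO C X)"
  proof -
    note St = SuspA_Hom[OF t] and Su = SuspA_Hom[OF u] and SX = SuspO_Obj[OF h(5)]
    have "neg C (SuspA C t) \<cdot> w = Null C Y (SuspO C U)" by (rule triangle_Cmp[OF rotate[OF r]])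
    then have "SuspA C t \<cdot> w = Null C Y (SuspO C U)"
      using neg_Cmp[OF h(3) St] neg_neg[OF Cmp_Hom[OF h(3) St]] neg_Null[OF h(7) SuspO_Obj[OF h(6)]]
      by simp
    then have "SuspA C u \<cdot> (SuspA C t \<cdot> w) = Null C Y (SuspO C X)"
      using Cmp_Null[OF Su h(7)] by simp
    moreover have "SuspA C u \<cdot> (SuspA C t \<cdot> w) = w"
      using Cmp_assoc[OF h(3) St Su] SuspA_Cmp[OF t u] ut SuspA_Ide[OF h(5)] Ide_Cmp[OF h(3)] by simp
    ultimately show ?thesis by simp
  qed
  then have "w \<cdot> Ide C Y = Null C Y (SuspO C X)" using Cmp_Ide[OF h(3)] by simp
  from weak_kernel[OF r Ide_Hom[OF h(7)] this] obtain j0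
    where j0: "j0 \<in> Hom C Y U" "Ide C Y = v \<cdot> j0" .
  have uj0: "u \<cdot> j0 \<in> Hom C Y X" by (rule Cmp_Hom[OF j0(1) u])
  have tuj0: "t \<cdot> (u \<cdot> j0) \<in> Hom C Y U" by (rule Cmp_Hom[OF uj0 t])
  \<comment> \<open>\<open>j0\<close> is a section of \<open>v\<close>; subtracting its component along \<open>t\<close> makes it vanish under \<open>u\<close>.\<close>
  define j where "j = diff j0 (t \<cdot> (u \<cdot> j0))"
  have j: "j \<in> Hom C Y U" unfolding j_def by (rule diff_Hom[OF j0(1) tuj0])
  have "v \<cdot> (t \<cdot> (u \<cdot> j0)) = Null C Y Y"
    using Cmp_assoc[OF uj0 t v] vt Null_Cmp[OF uj0 h(7)] by simp
  then have vj: "v \<cdot> j = Ide C Y"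
    unfolding j_def
    using Cmp_diff[OF j0(1) tuj0 v] j0(2) neg_Null[OF h(7) h(7)] Plus_Null[OF Ide_Hom[OF h(7)]] by simp
  have "u \<cdot> (t \<cdot> (u \<cdot> j0)) = u \<cdot> j0" using Cmp_assoc[OF uj0 t u] ut Ide_Cmp[OF uj0] by simp
  then have uj: "u \<cdot> j = Null C Y X"
    unfolding j_def using Cmp_diff[OF j0(1) tuj0 u] Plus_neg[OF uj0] by simp
  have tu: "t \<cdot> u \<in> Hom C U U" and jv: "j \<cdot> v \<in> Hom C U U" using Cmp_Hom t u j v by blast+
  have IU: "Ide C U \<in> Hom C U U" by (rule Ide_Hom[OF h(6)])
  have tujv: "Plus C (t \<cdot> u) (j \<cdot> v) \<in> Hom C U U" by (rule Plus_Hom[OF tu jv])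
  \<comment> \<open>The defect of the decomposition is killed by both projections \<open>u\<close> and \<open>v\<close>, hence is zero.\<close>
  define d where "d = diff (Ide C U) (Plus C (t \<cdot> u) (j \<cdot> v))"
  have d: "d \<in> Hom C U U" unfolding d_def by (rule diff_Hom[OF IU tujv])
  have "v \<cdot> Plus C (t \<cdot> u) (j \<cdot> v) = v"
    using Cmp_Plus[OF tu jv v] Cmp_assoc[OF u t v] Cmp_assoc[OF v j v] vt vj Null_Cmp[OF u h(7)]
      Ide_Cmp[OF v] Plus_Null[OF v] Plus_commute[OF v Null_Hom[OF h(6,7)]] by simp
  then have "v \<cdot> d = Null C U Y"
    unfolding d_def using Cmp_diff[OF IU tujv v] Cmp_Ide[OF v] Plus_neg[OF v] by simp
  from weak_kernel[OF tri d this] obtain k where k: "k \<in> Hom C U X" "d = t \<cdot> k" .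
  have "u \<cdot> Plus C (t \<cdot> u) (j \<cdot> v) = u"
    using Cmp_Plus[OF tu jv u] Cmp_assoc[OF u t u] Cmp_assoc[OF v j u] ut uj Null_Cmp[OF v h(5)]
      Ide_Cmp[OF u] Plus_Null[OF u] by simp
  then have "u \<cdot> d = Null C U X"
    unfolding d_def using Cmp_diff[OF IU tujv u] Cmp_Ide[OF u] Plus_neg[OF u] by simp
  then have "k = Null C U X" using k(2) Cmp_assoc[OF k(1) t u] ut Ide_Cmp[OF k(1)] by simp
  then have "d = Null C U U" using k(2) Cmp_Null[OF t h(6)] by simp
  then have "Plus C (t \<cdot> u) (j \<cdot> v) = Ide C U"
    unfolding d_def using diff_eq_Null_iff[OF IU tujv] by simp
  then have "direct_sum C 2 (\<lambda>k. if k = 0 then X else Y) U"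
    by (intro direct_sum_2[OF t u j v ut vj vt uj])
  then have "\<forall>k<2. (if k = (0::nat) then X else Y) \<in> M"
    using M unfolding summand_closed_def by blast
  then show ?thesis by (metis zero_less_numeral)
qed

text \<open>The second approximation is the desuspension of the first one, taken for \<open>\<Sigma>X\<close>.\<close>

lemma cotorsion_approximations:
  assumes c: "cotorsion_pair C S T" and X: "X \<in> Obj C"
  shows "\<exists>A \<in> S. \<exists>B \<in> T. \<exists>u v w. triangle A X (SuspO C B) u v w"
    and "\<exists>P \<in> Desusp C S. \<exists>B \<in> T. \<exists>u v w. triangle P X B u v w"
proof -
  have *: "\<exists>A \<in> S. \<exists>B \<in> T. \<exists>u v w. triangle A Y (SuspO C B) u v w" if "Y \<in> Obj C" for Y
    using c that star_iff[of Y S "Susp C T"] by (auto simp: cotorsion_pair_def Susp_def)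
  show "\<exists>A \<in> S. \<exists>B \<in> T. \<exists>u v w. triangle A X (SuspO C B) u v w" by (rule *[OF X])
  obtain A B u v w where AB: "A \<in> S" "B \<in> T" and t: "triangle A (SuspO C X) (SuspO C B) u v w"
    using *[OF SuspO_Obj[OF X]] by blast
  have B: "B \<in> Obj C" using c AB(2) by (auto simp: cotorsion_pair_def additive_subcat_def)
  obtain P where P: "P \<in> Obj C" "SuspO C P = A" using SuspO_surj triangle_Hom(5)[OF t] by blast
  obtain u' v' w' where "triangle P X B u' v' w'" using desuspend[OF _ P(1) X B] t P(2) by metis
  moreover have "P \<in> Desusp C S" using P AB by (simp add: Desusp_def)
  ultimately show "\<exists>P \<in> Desusp C S. \<exists>B \<in> T. \<exists>u v w. triangle P X B u v w"
    using AB(2) by blast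
qed

text \<open>The approximation \<open>A \<rightarrow> X \<rightarrow> \<Sigma>B\<close> of \<open>X \<in> S\<close> has zero second morphism, so \<open>X\<close> is a retract of
  \<open>A \<in> U\<close>.\<close>

lemma subset_of_ext_vanish:
  assumes c: "cotorsion_pair C U V" and e: "ext_vanish C S V" and S: "S \<subseteq> Obj C"
  shows "S \<subseteq> U"
proof
  fix X assume X: "X \<in> S"
  then have X': "X \<in> Obj C" using S by blast
  obtain A B u v w where AB: "A \<in> U" "B \<in> V" and t: "triangle A X (SuspO C B) u v w"
    using cotorsion_approximations(1)[OF c X'] by blast
  note h = triangle_Hom[OF t]
  have "v \<cdot> Ide C X = Null C X (SuspO C B)"
    using e X AB(2) h(2) Cmp_Ide[OF h(2)] by (auto simp: ext_vanish_def)
  from weak_kernel[OF t Ide_Hom[OF X'] this] obtain k where "k \<in> Hom C X A" "Ide C X = u \<cdot> k" .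
  then show "X \<in> U"
    using summand_closed_retract[OF _ AB(1) _ h(1)] c by (simp add: cotorsion_pair_def)
qed

end

section \<open>The quotient by the right half of a cotorsion pair\<close>

lemma Hom_full_subcat:
  "Hom (full_subcat C M) A B = (if A \<in> M \<and> B \<in> M then Hom C A B else {})"
  by (auto simp: Hom_def full_subcat_def)

lemma full_subcat_simps:
  "Obj (full_subcat C M) = M" "Dom (full_subcat C M) = Dom C" "Cod (full_subcat C M) = Cod C"
  "Ide (full_subcat C M) = Ide C" "Cmp (full_subcat C M) = Cmp C"
  by (simp_all add: full_subcat_def)

lemma full_subcat_precat_simps:
  fixes C :: "('o, 'm, 'z) precat_scheme"
  shows "Plus (full_subcat C M) = Plus C" "Null (full_subcat C M) = Null C"
  by (simp_all add: full_subcat_def)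

lemma neg_full_subcat:
  fixes C :: "('o, 'm, 'z) precat_scheme"
  assumes "f \<in> Hom C A B" "A \<in> M" "B \<in> M"
  shows "neg (full_subcat C M) f = neg C f"
  using assms
  by (simp add: neg_def hom_group_def full_subcat_simps full_subcat_precat_simps Hom_full_subcat
      Hom_Dom Hom_Cod)

text \<open>The single cotorsion pair that a twin cotorsion pair with \<open>T = U\<close> leaves to study.\<close>

locale included_cotorsion_pair = triangulated_category C
  for C :: "('o, 'm, 'z) tricat_scheme" (structure) +
  fixes S T :: "'o set"
  assumes cotorsion: "cotorsion_pair C S T" and S_subset_T: "S \<subseteq> T"
begin

abbreviation probes :: "'o set" where
  "probes \<equiv> Desusp C S"

lemma T_Obj: "B \<in> T \<Longrightarrow> B \<in> Obj C"
  using cotorsion by (auto simp: cotorsion_pair_def additive_subcat_def)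

lemma probe_Obj: "P \<in> probes \<Longrightarrow> P \<in> Obj C"
  by (simp add: Desusp_def)

lemma probe_to_T:
  assumes P: "P \<in> probes" and B: "B \<in> T" and s: "s \<in> Hom C P B"
  shows "s = Null C P B"
proof -
  have O: "P \<in> Obj C" "B \<in> Obj C" using Hom_Obj[OF s] by auto
  have "SuspA C s = Null C (SuspO C P) (SuspO C B)"
    using cotorsion P B SuspA_Hom[OF s] by (auto simp: cotorsion_pair_def ext_vanish_def Desusp_def)
  then show ?thesis using SuspA_inj[OF s Null_Hom[OF O]] SuspA_Null[OF O] by simp
qed

text \<open>The difference \<open>f - g\<close> factors through \<open>B \<in> T\<close>, which receives only zero maps from
  probes. One left approximation of \<open>A\<close> by a probe therefore detects everything that probes can
  see.\<close>

lemma agree_on_probes: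
  assumes t: "triangle P0 A B a b c" and B: "B \<in> T"
    and f: "f \<in> Hom C A Y" and g: "g \<in> Hom C A Y" and fga: "f \<cdot> a = g \<cdot> a"
    and P: "P \<in> probes" and s: "s \<in> Hom C P A"
  shows "f \<cdot> s = g \<cdot> s"
proof -
  note h = triangle_Hom[OF t]
  have Y: "Y \<in> Obj C" using Hom_Obj[OF f] by simp
  have "diff f g \<cdot> a = Null C P0 Y"
    using diff_Cmp[OF h(1) f g] fga Plus_neg[OF Cmp_Hom[OF h(1) g]] by simp
  from weak_cokernel[OF t diff_Hom[OF f g] this] obtain k where k: "k \<in> Hom C B Y" "diff f g = k \<cdot> b" .
  have "b \<cdot> s = Null C P B" by (rule probe_to_T[OF P B Cmp_Hom[OF s h(2)]])
  then have "diff f g \<cdot> s = Null C P Y"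
    using k(2) Cmp_assoc[OF s h(2) k(1)] Cmp_Null[OF k(1) probe_Obj[OF P]] by simp
  then show ?thesis
    using diff_Cmp[OF s f g] diff_eq_Null_iff[OF Cmp_Hom[OF s f] Cmp_Hom[OF s g]] by simp
qed

text \<open>This turns out to be the congruence class of \<open>f\<close> modulo \<open>[T]\<close>, and also modulo \<open>[S]\<close>
  on objects of \<open>\<Sigma>\<^sup>-\<^sup>1S * S\<close>; describing both by the same formula makes the two hearts comparable.\<close>

definition probe_class :: "'m \<Rightarrow> 'm set" where
  "probe_class f = {g \<in> Hom C (Dom C f) (Cod C f). \<forall>P \<in> probes. \<forall>s \<in> Hom C P (Dom C f). g \<cdot> s = f \<cdot> s}"

lemma probe_class_self: "f \<in> Arr C \<Longrightarrow> f \<in> probe_class f"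
  by (simp add: probe_class_def Arr_Hom)

lemma probe_class_Hom: "\<lbrakk>g \<in> probe_class f; f \<in> Hom C A B\<rbrakk> \<Longrightarrow> g \<in> Hom C A B"
  by (simp add: probe_class_def Hom_Dom Hom_Cod)

lemma probe_class_eq_iff:
  assumes "f \<in> Hom C A B" "g \<in> Hom C A B"
  shows "probe_class f = probe_class g \<longleftrightarrow> (\<forall>P \<in> probes. \<forall>s \<in> Hom C P A. f \<cdot> s = g \<cdot> s)"
proof
  assume "probe_class f = probe_class g"
  then have "f \<in> probe_class g" using probe_class_self[OF Hom_Arr[OF assms(1)]] by simp
  then show "\<forall>P \<in> probes. \<forall>s \<in> Hom C P A. f \<cdot> s = g \<cdot> s"
    by (simp add: probe_class_def Hom_Dom[OF assms(2)])
next
  assume "\<forall>P \<in> probes. \<forall>s \<in> Hom C P A. f \<cdot> s = g \<cdot> s"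
  then show "probe_class f = probe_class g"
    using Hom_Dom[OF assms(1)] Hom_Dom[OF assms(2)] Hom_Cod[OF assms(1)] Hom_Cod[OF assms(2)]
    by (simp add: probe_class_def)
qed

lemma probe_class_some:
  assumes "f \<in> Hom C A B"
  shows "(SOME g. g \<in> probe_class f) \<in> Hom C A B"
    "probe_class (SOME g. g \<in> probe_class f) = probe_class f"
proof -
  have g: "(SOME g. g \<in> probe_class f) \<in> probe_class f" (is "?g \<in> _")
    by (rule someI[of "\<lambda>g. g \<in> probe_class f", OF probe_class_self[OF Hom_Arr[OF assms]]])
  then show gH: "?g \<in> Hom C A B" using assms by (rule probe_class_Hom)
  show "probe_class ?g = probe_class f"
    using g probe_class_eq_iff[OF gH assms] by (simp add: probe_class_def Hom_Dom[OF assms])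
qed

lemma probe_class_Cmp:
  assumes f: "f \<in> Hom C A B" "f' \<in> Hom C A B" and g: "g \<in> Hom C B D" "g' \<in> Hom C B D"
    and ff: "probe_class f = probe_class f'" and gg: "probe_class g = probe_class g'"
  shows "probe_class (g \<cdot> f) = probe_class (g' \<cdot> f')"
proof -
  have "(g \<cdot> f) \<cdot> s = (g' \<cdot> f') \<cdot> s" if P: "P \<in> probes" and s: "s \<in> Hom C P A" for P s
  proof -
    have "f \<cdot> s = f' \<cdot> s" using ff probe_class_eq_iff[OF f] P s by blast
    moreover have "g \<cdot> (f' \<cdot> s) = g' \<cdot> (f' \<cdot> s)"
      using gg probe_class_eq_iff[OF g] P Cmp_Hom[OF s f(2)] by blast
    ultimately show ?thesis using Cmp_assoc[OF s f(1) g(1)] Cmp_assoc[OF s f(2) g(2)] by simp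
  qed
  then show ?thesis
    using probe_class_eq_iff[OF Cmp_Hom[OF f(1) g(1)] Cmp_Hom[OF f(2) g(2)]] by blast
qed

text \<open>The condition on a full subcategory \<open>M\<close> and a class \<open>W\<close> under which the ideal \<open>[W]\<close> of \<open>M\<close> is
  determined by probes. It is used for \<open>M\<close> all of \<open>C\<close> with \<open>W = T\<close>, and for \<open>M = \<Sigma>\<^sup>-\<^sup>1S * S\<close> with \<open>W = S\<close>.\<close>

definition approximable :: "'o set \<Rightarrow> 'o set \<Rightarrow> bool" where
  "approximable M W \<longleftrightarrow> W \<subseteq> M \<and> W \<subseteq> T \<and> M \<subseteq> star C probes W"

lemma approximable_Obj: "approximable M W \<Longrightarrow> A \<in> M \<Longrightarrow> A \<in> Obj C"
  by (auto simp: approximable_def star_def)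

text \<open>Maps from probes to \<open>W \<subseteq> T\<close> vanish; conversely a morphism that kills the probe in a triangle
  \<open>P \<rightarrow> A \<rightarrow> X\<close> extends along \<open>A \<rightarrow> X\<close> with \<open>X \<in> W\<close>.\<close>

lemma factoring_iff_kills_probes:
  assumes MW: "approximable M W" and A: "A \<in> M" and B: "B \<in> M" and h: "h \<in> Hom C A B"
  shows "h \<in> factoring (full_subcat C M) W \<longleftrightarrow> (\<forall>P \<in> probes. \<forall>s \<in> Hom C P A. h \<cdot> s = Null C P B)"
proof
  assume "h \<in> factoring (full_subcat C M) W"
  then obtain X k l where X: "X \<in> W" and k: "k \<in> Hom C A X" and l: "l \<in> Hom C X B"
    and hlk: "h = l \<cdot> k"
    using A B by (auto simp: factoring_def full_subcat_simps Hom_full_subcat Hom_Dom[OF h]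
        Hom_Cod[OF h] split: if_splits)
  have XT: "X \<in> T" using MW X by (auto simp: approximable_def)
  show "\<forall>P \<in> probes. \<forall>s \<in> Hom C P A. h \<cdot> s = Null C P B"
  proof (intro ballI)
    fix P s assume P: "P \<in> probes" and s: "s \<in> Hom C P A"
    have "k \<cdot> s = Null C P X" by (rule probe_to_T[OF P XT Cmp_Hom[OF s k]])
    then show "h \<cdot> s = Null C P B"
      using hlk Cmp_assoc[OF s k l] Cmp_Null[OF l probe_Obj[OF P]] by simp
  qed
next
  assume kill: "\<forall>P \<in> probes. \<forall>s \<in> Hom C P A. h \<cdot> s = Null C P B"
  have "A \<in> star C probes W" using MW A by (auto simp: approximable_def)
  then obtain P X a b c where P: "P \<in> probes" and X: "X \<in> W" and t: "triangle P A X a b c"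
    unfolding star_iff by blast
  note ht = triangle_Hom[OF t]
  have "h \<cdot> a = Null C P B" using kill P ht(1) by blast
  from weak_cokernel[OF t h this] obtain k where k: "k \<in> Hom C X B" "h = k \<cdot> b" .
  have "X \<in> M" using MW X by (auto simp: approximable_def)
  moreover have "h \<in> Arr (full_subcat C M)"
    using Hom_Arr[of h "full_subcat C M" A B] h A B by (simp add: Hom_full_subcat)
  moreover have "b \<in> Hom (full_subcat C M) A X" "k \<in> Hom (full_subcat C M) X B"
    using \<open>X \<in> M\<close> k(1) ht(2) A B by (simp_all add: Hom_full_subcat)
  ultimately show "h \<in> factoring (full_subcat C M) W"
    using X k(2)
    unfolding factoring_def mem_Collect_eq full_subcat_simps Hom_Dom[OF h] Hom_Cod[OF h] by blast
qed

lemma ideal_class_eq_probe_class: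
  assumes MW: "approximable M W" and A: "A \<in> M" and B: "B \<in> M" and f: "f \<in> Hom C A B"
  shows "ideal_class (full_subcat C M) W f = probe_class f"
proof -
  have "Plus C g (neg C f) \<in> factoring (full_subcat C M) W \<longleftrightarrow>
      (\<forall>P \<in> probes. \<forall>s \<in> Hom C P A. g \<cdot> s = f \<cdot> s)" if g: "g \<in> Hom C A B" for g
  proof -
    have "diff g f \<cdot> s = Null C P B \<longleftrightarrow> g \<cdot> s = f \<cdot> s" if s: "s \<in> Hom C P A" for P s
      using diff_Cmp[OF s g f] diff_eq_Null_iff[OF Cmp_Hom[OF s g] Cmp_Hom[OF s f]] by simp
    then show ?thesis using factoring_iff_kills_probes[OF MW A B diff_Hom[OF g f]] by blast
  qed
  then show ?thesis
    using A B by (auto simp: ideal_class_def probe_class_def full_subcat_simps Hom_full_subcat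
        full_subcat_precat_simps neg_full_subcat[OF f A B] Hom_Dom[OF f] Hom_Cod[OF f])
qed

abbreviation quot :: "'o set \<Rightarrow> 'o set \<Rightarrow> ('o, 'm set) cat" where
  "quot M W \<equiv> quotient_cat (full_subcat C M) W"

context
  fixes M W assumes MW: "approximable M W"
begin

lemma quot_Obj: "Obj (quot M W) = M"
  by (simp add: quotient_cat_def full_subcat_simps)

lemma quot_Ide: "A \<in> M \<Longrightarrow> Ide (quot M W) A = probe_class (Ide C A)"
  using ideal_class_eq_probe_class[OF MW _ _ Ide_Hom] approximable_Obj[OF MW]
  by (simp add: quotient_cat_def full_subcat_simps)

lemma quot_Arr: "Arr (quot M W) = (\<Union>A \<in> M. \<Union>B \<in> M. probe_class ` Hom C A B)"
proof -
  have "Arr (quot M W) = (\<Union>A \<in> M. \<Union>B \<in> M. ideal_class (full_subcat C M) W ` Hom C A B)"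
    by (auto simp: quotient_cat_def full_subcat_def Hom_def)
  also have "\<dots> = (\<Union>A \<in> M. \<Union>B \<in> M. probe_class ` Hom C A B)"
    using ideal_class_eq_probe_class[OF MW] by (intro SUP_cong image_cong) auto
  finally show ?thesis .
qed

lemma quot_Dom_Cod:
  assumes "f \<in> Hom C A B"
  shows "Dom (quot M W) (probe_class f) = A" "Cod (quot M W) (probe_class f) = B"
  using probe_class_some(1)[OF assms]
  by (simp_all add: quotient_cat_def full_subcat_simps Hom_def)

lemma quot_Hom:
  "Hom (quot M W) A B = (if A \<in> M \<and> B \<in> M then probe_class ` Hom C A B else {})"
proof -
  have "c \<in> Hom (quot M W) A B \<longleftrightarrow> A \<in> M \<and> B \<in> M \<and> c \<in> probe_class ` Hom C A B" for c
    using quot_Dom_Cod by (auto simp: Hom_def[of "quot M W"] quot_Arr)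
  then show ?thesis by auto
qed

lemma quot_Cmp:
  assumes f: "f \<in> Hom C A B" and g: "g \<in> Hom C B D" and M: "A \<in> M" "D \<in> M"
  shows "probe_class g \<cdot>\<^bsub>quot M W\<^esub> probe_class f = probe_class (g \<cdot> f)"
proof -
  note f' = probe_class_some[OF f] and g' = probe_class_some[OF g]
  have "probe_class g \<cdot>\<^bsub>quot M W\<^esub> probe_class f
      = probe_class ((SOME g'. g' \<in> probe_class g) \<cdot> (SOME f'. f' \<in> probe_class f))"
    using ideal_class_eq_probe_class[OF MW M Cmp_Hom[OF f'(1) g'(1)]]
    by (simp add: quotient_cat_def full_subcat_simps)
  also have "\<dots> = probe_class (g \<cdot> f)"
    by (rule probe_class_Cmp[OF f'(1) f g'(1) g f'(2) g'(2)])
  finally show ?thesis .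
qed

lemma category_quot: "category (quot M W)"
proof
  fix c assume "c \<in> Arr (quot M W)"
  then show "Dom (quot M W) c \<in> Obj (quot M W)" "Cod (quot M W) c \<in> Obj (quot M W)"
    using quot_Dom_Cod by (auto simp: quot_Arr quot_Obj)
next
  fix A assume "A \<in> Obj (quot M W)"
  then show "Ide (quot M W) A \<in> Hom (quot M W) A A"
    using Ide_Hom approximable_Obj[OF MW] by (auto simp: quot_Obj quot_Ide quot_Hom)
next
  fix f g A B D assume "f \<in> Hom (quot M W) A B" "g \<in> Hom (quot M W) B D"
  then show "g \<cdot>\<^bsub>quot M W\<^esub> f \<in> Hom (quot M W) A D"
    using quot_Cmp Cmp_Hom by (auto simp: quot_Hom split: if_splits)
next
  fix c A B assume "c \<in> Hom (quot M W) A B"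
  then obtain f where f: "f \<in> Hom C A B" "c = probe_class f" and M: "A \<in> M" "B \<in> M"
    by (auto simp: quot_Hom split: if_splits)
  note I = Ide_Hom[OF approximable_Obj[OF MW M(1)]] Ide_Hom[OF approximable_Obj[OF MW M(2)]]
  show "c \<cdot>\<^bsub>quot M W\<^esub> Ide (quot M W) A = c"
    using quot_Cmp[OF I(1) f(1) M] Cmp_Ide[OF f(1)] quot_Ide[OF M(1)] f(2) by simp
  show "Ide (quot M W) B \<cdot>\<^bsub>quot M W\<^esub> c = c"
    using quot_Cmp[OF f(1) I(2) M] Ide_Cmp[OF f(1)] quot_Ide[OF M(2)] f(2) by simp
next
  fix c d e A B D E
  assume "c \<in> Hom (quot M W) A B" "d \<in> Hom (quot M W) B D" "e \<in> Hom (quot M W) D E"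
  then obtain f g h where f: "f \<in> Hom C A B" "c = probe_class f"
    and g: "g \<in> Hom C B D" "d = probe_class g" and h: "h \<in> Hom C D E" "e = probe_class h"
    and M: "A \<in> M" "B \<in> M" "D \<in> M" "E \<in> M"
    by (auto simp: quot_Hom split: if_splits)
  show "(e \<cdot>\<^bsub>quot M W\<^esub> d) \<cdot>\<^bsub>quot M W\<^esub> c = e \<cdot>\<^bsub>quot M W\<^esub> (d \<cdot>\<^bsub>quot M W\<^esub> c)"
    using quot_Cmp[OF g(1) h(1) M(2,4)] quot_Cmp[OF f(1) g(1) M(1,3)]
      quot_Cmp[OF f(1) Cmp_Hom[OF g(1) h(1)] M(1,4)] quot_Cmp[OF Cmp_Hom[OF f(1) g(1)] h(1) M(1,4)]
      Cmp_assoc[OF f(1) g(1) h(1)] f(2) g(2) h(2) by simp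
qed

end

text \<open>Both quotients have probe classes as arrows, whatever \<open>W\<close> and \<open>W'\<close> are.\<close>

lemma full_subcategory_of_quot:
  assumes MW: "approximable M W" and MW': "approximable M' W'" and sub: "M' \<subseteq> M"
  shows "full_subcategory_of (quot M' W') (quot M W)"
  unfolding full_subcategory_of_def
proof (intro conjI ballI)
  show "Obj (quot M' W') \<subseteq> Obj (quot M W)" using sub by (simp add: quot_Obj[OF MW] quot_Obj[OF MW'])
next
  fix c assume "c \<in> Arr (quot M' W')"
  then show "Dom (quot M' W') c \<in> Obj (quot M' W')" "Cod (quot M' W') c \<in> Obj (quot M' W')"
    by (simp_all add: category.Dom_closed[OF category_quot[OF MW']]
        category.Cod_closed[OF category_quot[OF MW']])
next
  fix A B assume "A \<in> Obj (quot M' W')" "B \<in> Obj (quot M' W')"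
  then show "Hom (quot M' W') A B = Hom (quot M W) A B"
    using sub by (auto simp: quot_Obj[OF MW'] quot_Hom[OF MW] quot_Hom[OF MW'])
next
  fix A assume "A \<in> Obj (quot M' W')"
  then show "Ide (quot M' W') A = Ide (quot M W) A"
    using sub by (auto simp: quot_Obj[OF MW'] quot_Ide[OF MW] quot_Ide[OF MW'])
next
  fix A B X c d assume O: "A \<in> Obj (quot M' W')" "B \<in> Obj (quot M' W')" "X \<in> Obj (quot M' W')"
    and cd: "c \<in> Hom (quot M W) A B" "d \<in> Hom (quot M W) B X"
  then obtain f g where f: "f \<in> Hom C A B" "c = probe_class f"
    and g: "g \<in> Hom C B X" "d = probe_class g"
    by (auto simp: quot_Hom[OF MW] split: if_splits)
  have M: "A \<in> M'" "X \<in> M'" using O quot_Obj[OF MW'] by auto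
  then have M': "A \<in> M" "X \<in> M" using sub by auto
  show "d \<cdot>\<^bsub>quot M' W'\<^esub> c = d \<cdot>\<^bsub>quot M W\<^esub> c"
    using quot_Cmp[OF MW' f(1) g(1) M] quot_Cmp[OF MW f(1) g(1) M'] f(2) g(2) by simp
qed

section \<open>Regular arrows and coreflections\<close>

lemma approximable_Obj_T: "approximable (Obj C) T"
proof -
  have "Obj C \<subseteq> star C probes T"
    using cotorsion_approximations(2)[OF cotorsion] by (auto simp: star_iff)
  then show ?thesis using T_Obj by (auto simp: approximable_def)
qed

text \<open>\<open>X \<in> S\<close> belongs to \<open>\<Sigma>\<^sup>-\<^sup>1S * S\<close> by the triangle \<open>0 \<rightarrow> X \<rightarrow> X \<rightarrow> 0\<close>.\<close>

lemma approximable_extensions: "approximable (star C probes S) S"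
proof -
  have "X \<in> star C probes S" if X: "X \<in> S" for X
  proof -
    obtain Z where Z: "zero_object C Z" using ex_zero_object by blast
    have "SuspO C Z \<in> S"
      using cotorsion zero_object_SuspO[OF Z] direct_sum_0
      unfolding cotorsion_pair_def additive_subcat_def by blast
    then have "Z \<in> probes" using Z by (simp add: Desusp_def zero_object_def)
    moreover have "triangle Z X X (Null C Z X) (Ide C X) (Null C X (SuspO C Z))"
      using triangle_zero[OF T_Obj Z] X S_subset_T by blast
    ultimately show ?thesis unfolding star_iff using X by blast
  qed
  then show ?thesis using S_subset_T by (auto simp: approximable_def)
qed

abbreviation C_mod_T :: "('o, 'm set) cat" where
  "C_mod_T \<equiv> quot (Obj C) T"

lemmas C_mod_T_Obj = quot_Obj[OF approximable_Obj_T]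
lemmas C_mod_T_Cmp = quot_Cmp[OF approximable_Obj_T]

lemma C_mod_T_Hom: "Hom C_mod_T A B = probe_class ` Hom C A B"
  using Hom_Obj by (auto simp: quot_Hom[OF approximable_Obj_T])

text \<open>Probes are objects of \<open>C/[T]\<close> whose outgoing morphisms are not identified with one another,
  so a monomorphism can be tested against them; they suffice because they detect equality.\<close>

lemma monic_iff:
  assumes f: "f \<in> Hom C X Y"
  shows "monic C_mod_T (probe_class f) \<longleftrightarrow> (\<forall>P \<in> probes. inj_on (\<lambda>s. f \<cdot> s) (Hom C P X))"
proof
  assume m: "monic C_mod_T (probe_class f)"
  note O = Hom_Obj[OF f]
  show "\<forall>P \<in> probes. inj_on (\<lambda>s. f \<cdot> s) (Hom C P X)"
  proof (intro ballI inj_onI)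
    fix P s s' assume P: "P \<in> probes" and s: "s \<in> Hom C P X" and s': "s' \<in> Hom C P X"
      and eq: "f \<cdot> s = f \<cdot> s'"
    note PO = probe_Obj[OF P]
    have "probe_class f \<cdot>\<^bsub>C_mod_T\<^esub> probe_class s = probe_class f \<cdot>\<^bsub>C_mod_T\<^esub> probe_class s'"
      using C_mod_T_Cmp[OF s f PO O(2)] C_mod_T_Cmp[OF s' f PO O(2)] eq by simp
    then have "probe_class s = probe_class s'"
      using m s s' PO unfolding monic_def
      by (simp add: C_mod_T_Obj C_mod_T_Hom quot_Dom_Cod[OF approximable_Obj_T f])
    then have "s \<cdot> Ide C P = s' \<cdot> Ide C P"
      using probe_class_eq_iff[OF s s'] P Ide_Hom[OF PO] by blast
    then show "s = s'" using Cmp_Ide[OF s] Cmp_Ide[OF s'] by simp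
  qed
next
  assume inj: "\<forall>P \<in> probes. inj_on (\<lambda>s. f \<cdot> s) (Hom C P X)"
  note O = Hom_Obj[OF f]
  show "monic C_mod_T (probe_class f)"
    unfolding monic_def
  proof (intro conjI ballI impI)
    show "probe_class f \<in> Arr C_mod_T" using f by (intro Hom_Arr[of _ _ X Y]) (simp add: C_mod_T_Hom)
  next
    fix A c d assume "A \<in> Obj C_mod_T" and c: "c \<in> Hom C_mod_T A (Dom C_mod_T (probe_class f))"
      and d: "d \<in> Hom C_mod_T A (Dom C_mod_T (probe_class f))"
      and eq: "probe_class f \<cdot>\<^bsub>C_mod_T\<^esub> c = probe_class f \<cdot>\<^bsub>C_mod_T\<^esub> d"
    then obtain g h where g: "g \<in> Hom C A X" "c = probe_class g"
      and h: "h \<in> Hom C A X" "d = probe_class h"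
      by (auto simp: C_mod_T_Hom quot_Dom_Cod[OF approximable_Obj_T f])
    have A: "A \<in> Obj C" using Hom_Obj[OF g(1)] by simp
    have "probe_class (f \<cdot> g) = probe_class (f \<cdot> h)"
      using eq g h C_mod_T_Cmp[OF g(1) f A O(2)] C_mod_T_Cmp[OF h(1) f A O(2)] by simp
    then have fgh: "\<forall>P \<in> probes. \<forall>s \<in> Hom C P A. (f \<cdot> g) \<cdot> s = (f \<cdot> h) \<cdot> s"
      using probe_class_eq_iff[OF Cmp_Hom[OF g(1) f] Cmp_Hom[OF h(1) f]] by blast
    have "g \<cdot> s = h \<cdot> s" if P: "P \<in> probes" and s: "s \<in> Hom C P A" for P s
    proof -
      have "f \<cdot> (g \<cdot> s) = f \<cdot> (h \<cdot> s)"
        using fgh P s Cmp_assoc[OF s g(1) f] Cmp_assoc[OF s h(1) f] by simp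
      then show ?thesis
        using inj P Cmp_Hom[OF s g(1)] Cmp_Hom[OF s h(1)] by (auto simp: inj_on_def)
    qed
    then show "c = d" using probe_class_eq_iff[OF g(1) h(1)] g(2) h(2) by blast
  qed
qed

text \<open>If \<open>f\<close> is epic, the cone \<open>v\<close> of \<open>f\<close> vanishes in \<open>C/[T]\<close>, hence kills every map from a probe,
  and such a map lifts along \<open>f\<close> by the weak kernel property.\<close>

lemma epic_iff:
  assumes f: "f \<in> Hom C X Y"
  shows "epic C_mod_T (probe_class f) \<longleftrightarrow> (\<forall>P \<in> probes. Hom C P Y \<subseteq> (\<lambda>s. f \<cdot> s) ` Hom C P X)"
proof
  assume e: "epic C_mod_T (probe_class f)"
  obtain Z v w where t: "triangle X Y Z f v w" using ex_triangle[OF f] .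
  note h = triangle_Hom[OF t]
  have n: "Null C Y Z \<in> Hom C Y Z" using Null_Hom h(6,7) by blast
  have "v \<cdot> f = Null C Y Z \<cdot> f" using triangle_Cmp[OF t] Null_Cmp[OF f h(7)] by simp
  then have "probe_class v \<cdot>\<^bsub>C_mod_T\<^esub> probe_class f = probe_class (Null C Y Z) \<cdot>\<^bsub>C_mod_T\<^esub> probe_class f"
    using C_mod_T_Cmp[OF f h(2) h(5,7)] C_mod_T_Cmp[OF f n h(5,7)] by simp
  then have "probe_class v = probe_class (Null C Y Z)"
    using e h(2,7) n unfolding epic_def
    by (simp add: C_mod_T_Obj C_mod_T_Hom quot_Dom_Cod[OF approximable_Obj_T f])
  then have v: "\<forall>P \<in> probes. \<forall>s \<in> Hom C P Y. v \<cdot> s = Null C Y Z \<cdot> s"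
    using probe_class_eq_iff[OF h(2) n] by blast
  show "\<forall>P \<in> probes. Hom C P Y \<subseteq> (\<lambda>s. f \<cdot> s) ` Hom C P X"
  proof (intro ballI subsetI)
    fix P s assume P: "P \<in> probes" and s: "s \<in> Hom C P Y"
    have "v \<cdot> s = Null C P Z" using v P s Null_Cmp[OF s h(7)] by simp
    from weak_kernel[OF t s this] show "s \<in> (\<lambda>s. f \<cdot> s) ` Hom C P X" by blast
  qed
next
  assume surj: "\<forall>P \<in> probes. Hom C P Y \<subseteq> (\<lambda>s. f \<cdot> s) ` Hom C P X"
  note O = Hom_Obj[OF f]
  show "epic C_mod_T (probe_class f)"
    unfolding epic_def
  proof (intro conjI ballI impI)
    show "probe_class f \<in> Arr C_mod_T" using f by (intro Hom_Arr[of _ _ X Y]) (simp add: C_mod_T_Hom)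
  next
    fix B c d assume "B \<in> Obj C_mod_T" and "c \<in> Hom C_mod_T (Cod C_mod_T (probe_class f)) B"
      and "d \<in> Hom C_mod_T (Cod C_mod_T (probe_class f)) B"
      and eq: "c \<cdot>\<^bsub>C_mod_T\<^esub> probe_class f = d \<cdot>\<^bsub>C_mod_T\<^esub> probe_class f"
    then obtain g h where g: "g \<in> Hom C Y B" "c = probe_class g"
      and h: "h \<in> Hom C Y B" "d = probe_class h"
      by (auto simp: C_mod_T_Hom quot_Dom_Cod[OF approximable_Obj_T f])
    have B: "B \<in> Obj C" using Hom_Obj[OF g(1)] by simp
    have "probe_class (g \<cdot> f) = probe_class (h \<cdot> f)"
      using eq g h C_mod_T_Cmp[OF f g(1) O(1) B] C_mod_T_Cmp[OF f h(1) O(1) B] by simp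
    then have gfh: "\<forall>P \<in> probes. \<forall>s \<in> Hom C P X. (g \<cdot> f) \<cdot> s = (h \<cdot> f) \<cdot> s"
      using probe_class_eq_iff[OF Cmp_Hom[OF f g(1)] Cmp_Hom[OF f h(1)]] by blast
    have "g \<cdot> s = h \<cdot> s" if P: "P \<in> probes" and s: "s \<in> Hom C P Y" for P s
    proof -
      obtain s' where s': "s' \<in> Hom C P X" "s = f \<cdot> s'" using surj P s by blast
      then show ?thesis
        using gfh P Cmp_assoc[OF s'(1) f g(1)] Cmp_assoc[OF s'(1) f h(1)] by simp
    qed
    then show "c = d" using probe_class_eq_iff[OF g(1) h(1)] g(2) h(2) by blast
  qed
qed

lemma regular_iff:
  assumes f: "f \<in> Hom C X Y"
  shows "probe_class f \<in> regular_arrows C_mod_T \<longleftrightarrow>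
    (\<forall>P \<in> probes. bij_betw (\<lambda>s. f \<cdot> s) (Hom C P X) (Hom C P Y))"
  unfolding regular_arrows_def bij_betw_def using monic_iff[OF f] epic_iff[OF f] Cmp_Hom[OF _ f]
  by blast

text \<open>Let \<open>A \<in> \<Sigma>\<^sup>-\<^sup>1S * S\<close> and rotate its triangle to \<open>e : P1 \<rightarrow> P0\<close>, \<open>a : P0 \<rightarrow> A\<close> with both \<open>P0\<close> and
  \<open>P1\<close> probes. To lift \<open>g : A \<rightarrow> Y\<close> along a regular \<open>r\<close>, lift \<open>g \<cdot> a\<close> from \<open>P0\<close>. The lift kills \<open>e\<close>,
  because it does so after composition with \<open>r\<close>, and hence extends over \<open>a\<close>. The extension solves
  the problem on \<open>P0\<close>, which is enough modulo \<open>[T]\<close>.\<close>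

lemma colocal_extensions:
  assumes A: "A \<in> star C probes S"
  shows "colocal C_mod_T (regular_arrows C_mod_T) A"
proof -
  obtain P0 B a b c where P0: "P0 \<in> probes" and B: "B \<in> S" and t: "triangle P0 A B a b c"
    using A unfolding star_iff by blast
  note h = triangle_Hom[OF t]
  obtain P1 where P1: "P1 \<in> Obj C" "SuspO C P1 = B" using SuspO_surj h(7) by blast
  then have P1': "P1 \<in> probes" using B by (simp add: Desusp_def)
  obtain e where e: "triangle P1 P0 A e a b" using unrotate[OF _ P1(1)] t P1(2) by metis
  note he = triangle_Hom[OF e]
  have BT: "B \<in> T" using B S_subset_T by blast
  show ?thesis
    unfolding colocal_def
  proof (intro conjI allI ballI)
    show "A \<in> Obj C_mod_T" using h(6) by (simp add: C_mod_T_Obj)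
  next
    fix X Y c assume "c \<in> regular_arrows C_mod_T \<inter> Hom C_mod_T X Y"
    then obtain r where r: "r \<in> Hom C X Y" "c = probe_class r" and "probe_class r \<in> regular_arrows C_mod_T"
      by (auto simp: C_mod_T_Hom)
    then have bij: "bij_betw (\<lambda>s. r \<cdot> s) (Hom C P X) (Hom C P Y)" if "P \<in> probes" for P
      using regular_iff[OF r(1)] that by blast
    have monic: "monic C_mod_T (probe_class r)"
      using \<open>probe_class r \<in> regular_arrows C_mod_T\<close> by (simp add: regular_arrows_def)
    note XY = Hom_Obj[OF r(1)]
    have inj: "inj_on (\<lambda>d. c \<cdot>\<^bsub>C_mod_T\<^esub> d) (Hom C_mod_T A X)"
      using monic h(6) r(2) unfolding monic_def inj_on_def
      by (simp add: C_mod_T_Obj quot_Dom_Cod[OF approximable_Obj_T r(1)])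
    have "\<exists>d \<in> Hom C_mod_T A X. y = c \<cdot>\<^bsub>C_mod_T\<^esub> d" if y: "y \<in> Hom C_mod_T A Y" for y
    proof -
      obtain g where g: "g \<in> Hom C A Y" "y = probe_class g" using y by (auto simp: C_mod_T_Hom)
      have ga: "g \<cdot> a \<in> Hom C P0 Y" by (rule Cmp_Hom[OF h(1) g(1)])
      then obtain l where l: "l \<in> Hom C P0 X" "g \<cdot> a = r \<cdot> l"
        using bij[OF P0] unfolding bij_betw_def by blast
      have le: "l \<cdot> e \<in> Hom C P1 X" by (rule Cmp_Hom[OF he(1) l(1)])
      have "r \<cdot> (l \<cdot> e) = g \<cdot> (a \<cdot> e)"
        using Cmp_assoc[OF he(1) l(1) r(1)] Cmp_assoc[OF he(1) h(1) g(1)] l(2) by simp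
      also have "\<dots> = r \<cdot> Null C P1 X"
        using triangle_Cmp[OF e] Cmp_Null[OF g(1) P1(1)] Cmp_Null[OF r(1) P1(1)] by simp
      finally have "l \<cdot> e = Null C P1 X"
        using bij[OF P1'] le Null_Hom[OF P1(1) XY(1)] by (auto simp: bij_betw_def inj_on_def)
      from weak_cokernel[OF e l(1) this] obtain k where k: "k \<in> Hom C A X" "l = k \<cdot> a" .
      have rk: "r \<cdot> k \<in> Hom C A Y" by (rule Cmp_Hom[OF k(1) r(1)])
      have "(r \<cdot> k) \<cdot> a = g \<cdot> a" using Cmp_assoc[OF h(1) k(1) r(1)] k(2) l(2) by simp
      then have "probe_class (r \<cdot> k) = probe_class g"
        using probe_class_eq_iff[OF rk g(1)] agree_on_probes[OF t BT rk g(1)] by blast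
      then have "y = c \<cdot>\<^bsub>C_mod_T\<^esub> probe_class k" using C_mod_T_Cmp[OF k(1) r(1) h(6) XY(2)] g(2) r(2) by simp
      then show ?thesis using k(1) by (auto simp: C_mod_T_Hom)
    qed
    moreover have "c \<cdot>\<^bsub>C_mod_T\<^esub> d \<in> Hom C_mod_T A Y" if "d \<in> Hom C_mod_T A X" for d
      using category.Cmp_Hom[OF category_quot[OF approximable_Obj_T] that] r by (simp add: C_mod_T_Hom)
    ultimately show "bij_betw (\<lambda>d. c \<cdot>\<^bsub>C_mod_T\<^esub> d) (Hom C_mod_T A X) (Hom C_mod_T A Y)"
      unfolding bij_betw_def using inj by blast
  qed
qed

text \<open>Approximate \<open>X\<close> by \<open>P \<rightarrow> X \<rightarrow> T0\<close> and then \<open>T0\<close> by \<open>S1 \<rightarrow> T0 \<rightarrow> \<Sigma>T1\<close>. The fibre \<open>A\<close> of the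
  composite \<open>X \<rightarrow> T0 \<rightarrow> \<Sigma>T1\<close> is an extension of the two fibres \<open>P\<close> and \<open>S1\<close>. The morphism \<open>A \<rightarrow> X\<close> is
  bijective on maps from probes: the obstruction to lifting factors through \<open>T0\<close>, and the
  obstruction to uniqueness through \<open>T1\<close>.\<close>

lemma ex_coreflection:
  assumes X: "X \<in> Obj C"
  shows "\<exists>A \<in> star C probes S. \<exists>c \<in> regular_arrows C_mod_T. c \<in> Hom C_mod_T A X"
proof -
  obtain P T0 a b c where P: "P \<in> probes" and T0: "T0 \<in> T" and t0: "triangle P X T0 a b c"
    using cotorsion_approximations(2)[OF cotorsion X] by blast
  obtain S1 T1 m d n where S1: "S1 \<in> S" and T1: "T1 \<in> T" and t1: "triangle S1 T0 (SuspO C T1) m d n"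
    using cotorsion_approximations(1)[OF cotorsion T_Obj[OF T0]] by blast
  note h0 = triangle_Hom[OF t0] and h1 = triangle_Hom[OF t1]
  have db: "d \<cdot> b \<in> Hom C X (SuspO C T1)" by (rule Cmp_Hom[OF h0(2) h1(2)])
  obtain D k k' where t2: "triangle X (SuspO C T1) D (d \<cdot> b) k k'" using ex_triangle[OF db] .
  note h2 = triangle_Hom[OF t2]
  \<comment> \<open>The fibre is obtained by desuspending the cone \<open>D\<close> of the composite.\<close>
  obtain A where A: "A \<in> Obj C" "SuspO C A = D" using SuspO_surj h2(7) by blast
  obtain f g l where "triangle (SuspO C P) D (SuspO C S1) f g l"
    using cone_of_Cmp[OF rotate[OF t0] rotate[OF t1] t2] .
  then obtain f' g' l' where "triangle P A S1 f' g' l'"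
    using desuspend[of P A S1 f g l] A h0(5) h1(5) by metis
  then have AL: "A \<in> star C probes S" unfolding star_iff using P S1 by blast
  obtain r where r: "triangle A X (SuspO C T1) r (d \<cdot> b) k"
    using unrotate[of X "SuspO C T1" A] t2 A by metis
  obtain q where q: "triangle T1 A X q r (d \<cdot> b)"
    using unrotate[OF r T_Obj[OF T1]] .
  note hq = triangle_Hom[OF q]
  have "bij_betw (\<lambda>s. r \<cdot> s) (Hom C P' A) (Hom C P' X)" if P': "P' \<in> probes" for P'
    unfolding bij_betw_def
  proof (intro conjI inj_onI equalityI subsetI)
    fix s s' assume s: "s \<in> Hom C P' A" "s' \<in> Hom C P' A" and eq: "r \<cdot> s = r \<cdot> s'"
    have "r \<cdot> diff s s' = Null C P' X"
      using Cmp_diff[OF s hq(2)] eq Plus_neg[OF Cmp_Hom[OF s(2) hq(2)]] by simp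
    from weak_kernel[OF q diff_Hom[OF s] this] obtain u where u: "u \<in> Hom C P' T1" "diff s s' = q \<cdot> u" .
    then have "diff s s' = Null C P' A"
      using probe_to_T[OF P' T1 u(1)] Cmp_Null[OF hq(1) probe_Obj[OF P']] by simp
    then show "s = s'" using diff_eq_Null_iff[OF s] by simp
  next
    fix s assume "s \<in> (\<lambda>s. r \<cdot> s) ` Hom C P' A"
    then show "s \<in> Hom C P' X" using Cmp_Hom[OF _ hq(2)] by blast
  next
    fix s assume s: "s \<in> Hom C P' X"
    have "b \<cdot> s = Null C P' T0" by (rule probe_to_T[OF P' T0 Cmp_Hom[OF s h0(2)]])
    then have "(d \<cdot> b) \<cdot> s = Null C P' (SuspO C T1)"
      using Cmp_assoc[OF s h0(2) h1(2)] Cmp_Null[OF h1(2) probe_Obj[OF P']] by simp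
    from weak_kernel[OF r s this] show "s \<in> (\<lambda>s. r \<cdot> s) ` Hom C P' A" by blast
  qed
  then have "probe_class r \<in> regular_arrows C_mod_T" using regular_iff[OF hq(2)] by blast
  moreover have "probe_class r \<in> Hom C_mod_T A X" using hq(2) by (simp add: C_mod_T_Hom)
  ultimately show ?thesis using AL by blast
qed

lemma localisation_equivalent_extensions:
  "equivalent_cats (localisation C_mod_T (regular_arrows C_mod_T)) (quot (star C probes S) S)"
proof (rule category.localisation_equivalent_colocal_subcategory[OF category_quot[OF approximable_Obj_T]])
  have "star C probes S \<subseteq> Obj C" by (auto simp: star_def)
  then show "full_subcategory_of (quot (star C probes S) S) C_mod_T"
    by (rule full_subcategory_of_quot[OF approximable_Obj_T approximable_extensions])
  show "colocal C_mod_T (regular_arrows C_mod_T) A" if "A \<in> Obj (quot (star C probes S) S)" for A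
    using that colocal_extensions by (simp add: quot_Obj[OF approximable_extensions])
  show "\<exists>A \<in> Obj (quot (star C probes S) S). \<exists>r \<in> regular_arrows C_mod_T. r \<in> Hom C_mod_T A X"
    if "X \<in> Obj C_mod_T" for X
    using that ex_coreflection by (simp add: C_mod_T_Obj quot_Obj[OF approximable_extensions])
qed

end

text \<open>Applied to \<open>(S, T)\<close> and to \<open>(T, V)\<close>, this removes every restriction on the objects of the heart
  of the twin cotorsion pair, and leaves only the left one for the heart of \<open>(S, T)\<close>.\<close>

lemma (in triangulated_category) cotorsion_pair_stars:
  assumes "cotorsion_pair C S T"
  shows "star C (Desusp C S) T = Obj C" "star C S (Susp C T) = Obj C"
proof -
  show "star C S (Susp C T) = Obj C" using assms by (simp add: cotorsion_pair_def)
  have "X \<in> star C (Desusp C S) T" if "X \<in> Obj C" for X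
    unfolding star_iff by (rule cotorsion_approximations(2)[OF assms that])
  then show "star C (Desusp C S) T = Obj C" by (auto simp: star_def)
qed

theorem theorem4p8:
  fixes C :: "('o, 'm) tricat" and S T U V :: "'o set"
  assumes "krull_schmidt C"
    and "triangulated_category C"
    and "twin_cotorsion_pair C S T U V"
    and "T = U"
  shows "equivalent_cats
           (localisation (twin_heart C S T U V) (regular_arrows (twin_heart C S T U V)))
           (heart C S T)"
proof -
  interpret triangulated_category C by fact
  have ST: "cotorsion_pair C S T" and TV: "cotorsion_pair C T V" and SV: "ext_vanish C S V"
    using assms(3,4) by (auto simp: twin_cotorsion_pair_def)
  have S: "S \<subseteq> Obj C" using ST by (auto simp: cotorsion_pair_def additive_subcat_def)
  have sub: "S \<subseteq> T" by (rule subset_of_ext_vanish[OF TV SV S])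
  interpret included_cotorsion_pair C S T by unfold_locales (fact ST, fact sub)
  have "twin_heart C S T U V = C_mod_T"
    using cotorsion_pair_stars[OF ST] cotorsion_pair_stars[OF TV] assms(4)
    by (simp add: twin_heart_def Let_def)
  moreover have "heart C S T = quot (star C probes S) S"
  proof -
    have "S \<inter> T = S" using sub by blast
    moreover have "star C probes S \<inter> Obj C = star C probes S" by (auto simp: star_def)
    ultimately show ?thesis using cotorsion_pair_stars[OF ST] by (simp add: heart_def Let_def)
  qed
  ultimately show ?thesis using localisation_equivalent_extensions by simp
qed

end
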